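(* Let $(E,d,m)$ be a locally compact, separable, connected metric measure space with $\mathrm{diam}(E)=1$, $m(E)<\infty$ and $\mathrm{supp}[m]=E$. Let $X$ be an $m$-symmetric Hunt process on $E$ with transition density $p_t(\cdot,\cdot)$ with respect to $m$. Suppose there exist positive constants $c_1,\dots,c_5$, $d_{\mathrm f}\ge1$ and $d_{\mathrm w}\ge2$ such that $$c_1t^{-d_{\mathrm f}/d_{\mathrm w}}\le p_t(x,x),$$ $$p_t(x,y)\le c_2t^{-d_{\mathrm f}/d_{\mathrm w}}\exp\Bigl\{-c_3\Bigl(\frac{d(x,y)^{d_{\mathrm w}}}{t}\Bigr)^{1/(d_{\mathrm w}-1)}\Bigr\},$$ $$c_4r^{d_{\mathrm f}}\le m(B(x,r))\le c_5r^{d_{\mathrm f}}$$ for all $x,y\in E$, $r\in(0,1]$ and $t\in(0,1]$. If an integer $p\ge2$ satisfies $d_{\mathrm f}-p(d_{\mathrm f}-d_{\mathrm w})>0$, then $X$ satisfies Assumption (A) for this $p$ (defined in the context).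
   Context: Assumption (A) for an $m$-symmetric Hunt process $X$ with transition probabilities $p_t(x,dy)$ and $L^2(E;m)$-semigroup $\{T_t\}$, and an integer $p\ge2$, means that all of the following hold: (A1) for every $\varepsilon>0$ there is a compact $K\subset E$ with $\sup_{x\in E}R_1 1_{K^c}(x)\le\varepsilon$, where $R_1g(x)=\int_0^\infty e^{-t}\int_E g(y)p_t(x,dy)\,dt$; (A2) for each $t>0$, $x\in E$, $p_t(x,dy)$ is absolutely continuous with respect to $m$, and its density $p_t(\cdot,\cdot)$ is continuous and uniformly bounded on $E\times E$; (A3) there exist $\rho>0$, $t_0>0$, $C>0$ with $C^{-1}t^{-\rho/2}\le\int_E p_t(x,x)\,m(dx)\le Ct^{-\rho/2}$ for all $t\in(0,t_0]$; (A4) there exist $\mu\in(2,\frac{2p}{p-1})$, $C>0$, $t_0>0$ with $\|T_t\|_{L^1\to L^\infty}\le Ct^{-\mu/2}$ for all $t\in(0,t_0]$; (A5) $\sup_{x\in E}\int_E R_1(x,y)^p\,m(dy)<\infty$ and $\lim_{\delta\downarrow0}\sup_{x\in E}\int_E R_{1,\delta}(x,y)^p\,m(dy)=0$, where $R_1(x,y)=\int_0^\infty e^{-t}p_t(x,y)\,dt$ and $R_{1,\delta}(x,y)=\int_0^\delta e^{-t}p_t(x,y)\,dt$. $B(x,r)$ is the ball of radius $r$ centered at $x$.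
   Formalization: The transition density p_t(x,y) is additionally assumed continuous in x and in y separately for each t>0; without it the claim fails (e.g. two discs glued at a polar point, with Brownian motion run separately in each disc). *)

theory Defs
  imports "HOL-Probability.Probability"
begin

section \<open>Hunt processes\<close>

text \<open>
  The state space \<open>E\<close> is the type \<open>'a\<close>; for metric spaces separability is the class
  \<^class>\<open>second_countable_topology\<close>. The cemetery \<open>\<Delta>\<close> is \<^const>\<open>None\<close>, and \<open>E\<^sub>\<Delta> = 'a option\<close> carries
  the one-point compactification topology (\<open>\<Delta>\<close> is isolated if \<open>E\<close> is compact).
\<close>

abbreviation cemetery_top :: "'a::topological_space option topology" where
  "cemetery_top \<equiv> Alexandroff_compactification euclidean"

definition cemetery_borel :: "'a::topological_space option measure" where
  "cemetery_borel = sigma UNIV {U. openin cemetery_top U}"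

definition lifetime :: "(ennreal \<Rightarrow> 'w \<Rightarrow> 'a option) \<Rightarrow> 'w \<Rightarrow> ennreal" where
  "lifetime X \<omega> = Inf {t. X t \<omega> = None}"

text \<open>
  \<open>M\<close> is the measurable space \<open>\<Omega>\<close> (its measure part plays no role), \<open>X t \<omega>\<close> the path with time
  running through \<open>[0, \<infinity>]\<close>, and \<open>P x\<close> the law started at \<open>x \<in> E\<^sub>\<Delta>\<close>. The definition is that of
  Fukushima, Oshima and Takeda. Requiring \<open>P\<close> to be a measurable kernel on all of \<open>M\<close> makes
  \<open>P\<^sub>\<mu> = \<integral> P\<^sub>x \<mu>(dx)\<close> meaningful without completions; for \<open>M = \<sigma>(X\<^sub>s, s \<ge> 0)\<close> it is measurability of
  \<open>x \<mapsto> P\<^sub>x(X\<^sub>t \<in> A)\<close>. The strong Markov property at constant times is the Markov property.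
\<close>

definition hunt_process ::
  "'w measure \<Rightarrow> (ennreal \<Rightarrow> 'w \<Rightarrow> 'a::{metric_space, second_countable_topology} option) \<Rightarrow>
   ('a option \<Rightarrow> 'w measure) \<Rightarrow> bool" where
  "hunt_process M X P \<longleftrightarrow>
     P \<in> cemetery_borel \<rightarrow>\<^sub>M prob_algebra M \<and>
     (\<forall>x. AE \<omega> in P x. X 0 \<omega> = x) \<and>
     (\<forall>t. AE \<omega> in P None. X t \<omega> = None) \<and>
     (\<forall>\<omega>\<in>space M.
        X \<infinity> \<omega> = None \<and>
        (\<forall>t\<ge>lifetime X \<omega>. X t \<omega> = None) \<and>
        (\<forall>t<\<infinity>. limitin cemetery_top (\<lambda>s. X s \<omega>) (X t \<omega>) (at_right t)) \<and>
        (\<forall>t. 0 < t \<and> t < \<infinity> \<longrightarrow> (\<exists>l. limitin cemetery_top (\<lambda>s. X s \<omega>) l (at_left t)))) \<and>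
     (\<forall>t. \<exists>\<theta>. \<theta> \<in> space M \<rightarrow> space M \<and> (\<forall>s. \<forall>\<omega>\<in>space M. X s (\<theta> \<omega>) = X (s + t) \<omega>)) \<and>
     (\<exists>F :: ennreal \<Rightarrow> 'w measure.
        filtration (space M) F \<and>
        (\<forall>t. sets (F t) \<subseteq> sets M) \<and>
        (\<forall>t. X t \<in> F t \<rightarrow>\<^sub>M cemetery_borel) \<and>
        (\<forall>t<\<infinity>. sets (F t) = (\<Inter>s\<in>{t<..}. sets (F s))) \<and>
        (\<forall>\<mu>\<in>space (prob_algebra cemetery_borel). \<forall>\<sigma>. stopping_time F \<sigma> \<longrightarrow>
           (\<forall>s. \<forall>A\<in>sets cemetery_borel.
              AE \<omega> in Giry_Monad.bind \<mu> P.
                real_cond_exp (Giry_Monad.bind \<mu> P) (filtration.pre_sigma (space M) F \<sigma>)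
                  (indicat_real {\<omega>'\<in>space M. X (\<sigma> \<omega>' + s) \<omega>' \<in> A}) \<omega>
                = measure (P (X (\<sigma> \<omega>) \<omega>)) {\<omega>'\<in>space M. X s \<omega>' \<in> A})) \<and>
        (\<forall>\<mu>\<in>space (prob_algebra cemetery_borel). \<forall>\<sigma>n \<sigma>.
           (\<forall>n::nat. stopping_time F (\<sigma>n n)) \<and> stopping_time F \<sigma> \<and>
           (\<forall>\<omega>\<in>space M. incseq (\<lambda>n. \<sigma>n n \<omega>) \<and> \<sigma> \<omega> = (SUP n. \<sigma>n n \<omega>)) \<longrightarrow>
           (AE \<omega> in Giry_Monad.bind \<mu> P. \<sigma> \<omega> < \<infinity> \<longrightarrow>
              limitin cemetery_top (\<lambda>n. X (\<sigma>n n \<omega>) \<omega>) (X (\<sigma> \<omega>) \<omega>) sequentially)))"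

text \<open>\<open>p\<^sub>t(x, dy) = P\<^sub>x(X\<^sub>t \<in> dy, t < \<zeta>)\<close>, a sub-probability on \<open>E\<close>.\<close>

definition transition_prob ::
  "(ennreal \<Rightarrow> 'w \<Rightarrow> 'a::topological_space option) \<Rightarrow> ('a option \<Rightarrow> 'w measure) \<Rightarrow>
   real \<Rightarrow> 'a \<Rightarrow> 'a measure" where
  "transition_prob X P t x =
     distr (restrict_space (P (Some x)) {\<omega>. X (ennreal t) \<omega> \<noteq> None}) borel
       (\<lambda>\<omega>. the (X (ennreal t) \<omega>))"

definition symmetric_wrt ::
  "'a::topological_space measure \<Rightarrow> (real \<Rightarrow> 'a \<Rightarrow> 'a measure) \<Rightarrow> bool" where
  "symmetric_wrt m Q \<longleftrightarrow>
     (\<forall>t\<ge>0. \<forall>f\<in>borel_measurable borel. \<forall>g\<in>borel_measurable borel.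
        (\<integral>\<^sup>+x. f x * (\<integral>\<^sup>+y. g y \<partial>Q t x) \<partial>m) = (\<integral>\<^sup>+x. (\<integral>\<^sup>+y. f y \<partial>Q t x) * g x \<partial>m))"

definition transition_density ::
  "'a::topological_space measure \<Rightarrow> (real \<Rightarrow> 'a \<Rightarrow> 'a measure) \<Rightarrow> (real \<Rightarrow> 'a \<Rightarrow> 'a \<Rightarrow> real) \<Rightarrow> bool" where
  "transition_density m Q q \<longleftrightarrow>
     (\<forall>t>0. \<forall>x. q t x \<in> borel_measurable borel \<and> (\<forall>y. 0 \<le> q t x y) \<and>
        Q t x = density m (\<lambda>y. ennreal (q t x y)))"

definition measure_support :: "'a::topological_space measure \<Rightarrow> 'a set" where
  "measure_support m = {x. \<forall>U. open U \<and> x \<in> U \<longrightarrow> emeasure m U > 0}"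


section \<open>Assumption (A)\<close>

definition resolvent1 :: "(real \<Rightarrow> 'a \<Rightarrow> 'a measure) \<Rightarrow> ('a \<Rightarrow> ennreal) \<Rightarrow> 'a \<Rightarrow> ennreal" where
  "resolvent1 Q g x = (\<integral>\<^sup>+t\<in>{0<..}. ennreal (exp (- t)) * (\<integral>\<^sup>+y. g y \<partial>Q t x) \<partial>lborel)"

text \<open>
  Measurability of \<open>t \<mapsto> q t x y\<close> is not imposed: if \<open>q\<close> is the density of a Hunt process and
  continuous in \<open>y\<close>, then \<open>q t x y\<close> is the limit of \<open>p\<^sub>t(x, B(y, r)) / m(B(y, r))\<close> as \<open>r \<down> 0\<close>, and
  these are measurable in \<open>t\<close> by right continuity of the paths.
\<close>

definition resolvent1_density :: "(real \<Rightarrow> 'a \<Rightarrow> 'a \<Rightarrow> real) \<Rightarrow> 'a \<Rightarrow> 'a \<Rightarrow> ennreal" where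
  "resolvent1_density q x y = (\<integral>\<^sup>+t\<in>{0<..}. ennreal (exp (- t) * q t x y) \<partial>lborel)"

definition resolvent1_density_upto ::
  "real \<Rightarrow> (real \<Rightarrow> 'a \<Rightarrow> 'a \<Rightarrow> real) \<Rightarrow> 'a \<Rightarrow> 'a \<Rightarrow> ennreal" where
  "resolvent1_density_upto \<delta> q x y = (\<integral>\<^sup>+t\<in>{0<..\<delta>}. ennreal (exp (- t) * q t x y) \<partial>lborel)"

definition semigroup_op :: "(real \<Rightarrow> 'a \<Rightarrow> 'a measure) \<Rightarrow> real \<Rightarrow> ('a \<Rightarrow> real) \<Rightarrow> 'a \<Rightarrow> real" where
  "semigroup_op Q t f x = (\<integral>y. f y \<partial>Q t x)"

text \<open>
  \<open>\<parallel>T\<^sub>t\<parallel>\<close> from \<open>L\<^sup>1\<close> to \<open>L\<^sup>\<infinity>\<close>, \<open>T\<^sub>t\<close> being given on \<open>L\<^sup>2\<close>: the supremum runs over \<open>L\<^sup>1 \<inter> L\<^sup>2\<close>.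
\<close>

definition norm_L1_Linf ::
  "'a measure \<Rightarrow> (('a \<Rightarrow> real) \<Rightarrow> 'a \<Rightarrow> real) \<Rightarrow> ennreal" where
  "norm_L1_Linf m T =
     (SUP f\<in>{f. integrable m f \<and> integrable m (\<lambda>x. (f x)\<^sup>2) \<and> (\<integral>x. \<bar>f x\<bar> \<partial>m) \<le> 1}.
        esssup m (\<lambda>x. ennreal \<bar>T f x\<bar>))"

text \<open>
  \<open>Q\<close> is the transition function, \<open>q\<close> its density and \<open>p\<close> the integer exponent.
\<close>

definition assumption_A1 :: "(real \<Rightarrow> 'a::metric_space \<Rightarrow> 'a measure) \<Rightarrow> bool" where
  "assumption_A1 Q \<longleftrightarrow>
     (\<forall>\<epsilon>>0. \<exists>K. compact K \<and> (SUP x. resolvent1 Q (indicator (- K)) x) \<le> ennreal \<epsilon>)"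

definition assumption_A2 ::
  "'a::metric_space measure \<Rightarrow> (real \<Rightarrow> 'a \<Rightarrow> 'a measure) \<Rightarrow> (real \<Rightarrow> 'a \<Rightarrow> 'a \<Rightarrow> real) \<Rightarrow> bool" where
  "assumption_A2 m Q q \<longleftrightarrow>
     (\<forall>t>0. \<forall>x. absolutely_continuous m (Q t x)) \<and>
     transition_density m Q q \<and>
     (\<forall>t>0. continuous_on UNIV (\<lambda>(x, y). q t x y) \<and> (\<exists>C. \<forall>x y. q t x y \<le> C))"

definition assumption_A3 :: "'a measure \<Rightarrow> (real \<Rightarrow> 'a \<Rightarrow> 'a \<Rightarrow> real) \<Rightarrow> bool" where
  "assumption_A3 m q \<longleftrightarrow>
     (\<exists>\<rho>>0. \<exists>t0>0. \<exists>C>0. \<forall>t\<in>{0<..t0}.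
        ennreal (inverse C * t powr (- (\<rho> / 2))) \<le> (\<integral>\<^sup>+x. ennreal (q t x x) \<partial>m) \<and>
        (\<integral>\<^sup>+x. ennreal (q t x x) \<partial>m) \<le> ennreal (C * t powr (- (\<rho> / 2))))"

definition assumption_A4 :: "'a measure \<Rightarrow> (real \<Rightarrow> 'a \<Rightarrow> 'a measure) \<Rightarrow> nat \<Rightarrow> bool" where
  "assumption_A4 m Q p \<longleftrightarrow>
     (\<exists>\<mu>. 2 < \<mu> \<and> \<mu> < 2 * real p / (real p - 1) \<and>
       (\<exists>C>0. \<exists>t0>0. \<forall>t\<in>{0<..t0}.
          norm_L1_Linf m (semigroup_op Q t) \<le> ennreal (C * t powr (- (\<mu> / 2)))))"

definition assumption_A5 :: "'a measure \<Rightarrow> (real \<Rightarrow> 'a \<Rightarrow> 'a \<Rightarrow> real) \<Rightarrow> nat \<Rightarrow> bool" where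
  "assumption_A5 m q p \<longleftrightarrow>
     (SUP x. \<integral>\<^sup>+y. resolvent1_density q x y ^ p \<partial>m) < \<infinity> \<and>
     ((\<lambda>\<delta>. SUP x. \<integral>\<^sup>+y. resolvent1_density_upto \<delta> q x y ^ p \<partial>m) \<longlongrightarrow> 0) (at_right 0)"

definition assumption_A ::
  "'a::metric_space measure \<Rightarrow> (real \<Rightarrow> 'a \<Rightarrow> 'a measure) \<Rightarrow> (real \<Rightarrow> 'a \<Rightarrow> 'a \<Rightarrow> real) \<Rightarrow> nat \<Rightarrow> bool" where
  "assumption_A m Q q p \<longleftrightarrow>
     assumption_A1 Q \<and> assumption_A2 m Q q \<and> assumption_A3 m q \<and>
     assumption_A4 m Q p \<and> assumption_A5 m q p"

end

theory Submission
  imports Defs "HOL-Real_Asymp.Real_Asymp"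
begin

text \<open>
  Put \<open>a = d\<^sub>f / d\<^sub>w\<close>. The hypothesis on \<open>p\<close> says \<open>a < p / (p - 1)\<close>, equivalently \<open>a - 1 < a / p\<close>.

  The strong Markov property at constant times gives the Chapman-Kolmogorov equation for the
  transition function. Averaging it over shrinking balls around the end point turns it into the
  pointwise identity \<open>q\<^sub>t\<^sub>+\<^sub>s(x, y) = \<integral> q\<^sub>t(x, z) q\<^sub>s(z, y) m(dz)\<close>; no joint measurability of
  \<open>(z, y) \<mapsto> q\<^sub>s(z, y)\<close> is needed. It bounds \<open>q\<^sub>t\<close> for all \<open>t\<close> away from \<open>0\<close>, and dominated convergence
  in it gives joint continuity (A2). (A3) and (A4) follow from the on-diagonal bounds, (A1) from
  inner regularity of \<open>m\<close>.

  For (A5) choose \<open>k\<close> with \<open>max 0 (a - 1) < k < a / p\<close>. Since \<open>exp (- c u)\<close> is dominated by any negative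
  power of \<open>u\<close>, the upper bound yields \<open>q\<^sub>t(x, y) \<le> B t\<^bsup>k - a\<^esup> d(x, y)\<^bsup>- k d\<^sub>w\<^esup>\<close> for \<open>t \<le> 1\<close>. The power of \<open>t\<close> is
  integrable at \<open>0\<close> because \<open>k > a - 1\<close>, and the \<open>p\<close>-th power of the power of \<open>d(x, y)\<close> is integrable
  uniformly in \<open>x\<close> because \<open>k d\<^sub>w p < d\<^sub>f\<close>.
\<close>

section \<open>The Chapman-Kolmogorov equation of a Hunt process\<close>

lemma space_cemetery_borel [simp]: "space cemetery_borel = UNIV"
  by (simp add: cemetery_borel_def space_measure_of_conv)

lemma Some_image_in_cemetery_borel:
  fixes A :: "'a::topological_space set"
  assumes "A \<in> sets borel"
  shows "Some ` A \<in> sets cemetery_borel"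
proof -
  have open_case: "Some ` U \<in> sets cemetery_borel" if "open U" for U :: "'a set"
    unfolding cemetery_borel_def using that by auto
  have "A \<in> sigma_sets UNIV (Collect open)"
    using assms by (simp add: borel_def)
  then show ?thesis
  proof (induction rule: sigma_sets.induct)
    case (Basic S) then show ?case using open_case by simp
  next
    case Empty show ?case by simp
  next
    case (Compl S)
    have "Some ` (UNIV - S) = Some ` UNIV - Some ` S" by auto
    then show ?case using Compl open_case[of UNIV] by auto
  next
    case (Union S)
    have "Some ` (\<Union>i. S i) = (\<Union>i. Some ` S i)" by auto
    then show ?case using Union by auto
  qed
qed

lemma measurable_Some_cemetery_borel:
  "(Some :: 'a::topological_space \<Rightarrow> _) \<in> borel \<rightarrow>\<^sub>M cemetery_borel"
  unfolding cemetery_borel_def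
proof (rule measurable_measure_of)
  fix U :: "'a option set" assume "U \<in> {U. openin cemetery_top U}"
  then have "openin euclidean {x \<in> topspace euclidean. Some x \<in> U}"
    using continuous_map_Some[of "euclidean :: 'a topology"] by (auto simp: continuous_map)
  then show "Some -` U \<inter> space borel \<in> sets borel"
    by (simp add: vimage_def)
qed auto

lemma measurable_the_cemetery_borel:
  "the \<in> restrict_space cemetery_borel (- {None}) \<rightarrow>\<^sub>M (borel :: 'a::topological_space measure)"
proof (rule measurableI)
  fix A :: "'a set" assume "A \<in> sets borel"
  then have "Some ` A \<in> sets cemetery_borel" by (rule Some_image_in_cemetery_borel)
  moreover have "the -` A \<inter> space (restrict_space cemetery_borel (- {None})) = - {None} \<inter> Some ` A"
  proof (rule set_eqI)
    show "\<xi> \<in> the -` A \<inter> space (restrict_space cemetery_borel (- {None})) \<longleftrightarrow>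
      \<xi> \<in> - {None} \<inter> Some ` A" for \<xi>
      by (cases \<xi>) (auto simp: space_restrict_space)
  qed
  ultimately show "the -` A \<inter> space (restrict_space cemetery_borel (- {None}))
      \<in> sets (restrict_space cemetery_borel (- {None}))"
    unfolding sets_restrict_space by simp
qed auto

lemma sets_transition_prob [simp]: "sets (transition_prob X P t x) = sets borel"
  by (simp add: transition_prob_def)

section \<open>Consequences of the Hunt process axioms\<close>

lemma hunt_process_kernel:
  assumes "hunt_process M X P"
  shows "P \<in> cemetery_borel \<rightarrow>\<^sub>M prob_algebra M"
  using assms unfolding hunt_process_def by (elim conjE)

lemma hunt_process_cemetery:
  assumes "hunt_process M X P"
  shows "AE \<omega> in P None. X t \<omega> = None"
  using assms unfolding hunt_process_def by (elim conjE) (erule spec)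

text \<open>Measurability and the Markov property refer to one and the same existentially bound
  filtration, so they are extracted together.\<close>

lemma hunt_process_strong_Markov:
  assumes "hunt_process M X P"
  obtains F where "filtration (space M) F" "\<And>t. sets (F t) \<subseteq> sets M"
    "\<And>t. X t \<in> F t \<rightarrow>\<^sub>M cemetery_borel"
    "\<And>\<mu> \<sigma> s A. \<mu> \<in> space (prob_algebra cemetery_borel) \<Longrightarrow> stopping_time F \<sigma> \<Longrightarrow>
       A \<in> sets cemetery_borel \<Longrightarrow>
       AE \<omega> in Giry_Monad.bind \<mu> P.
         real_cond_exp (Giry_Monad.bind \<mu> P) (filtration.pre_sigma (space M) F \<sigma>)
           (indicat_real {\<omega>'\<in>space M. X (\<sigma> \<omega>' + s) \<omega>' \<in> A}) \<omega>
         = measure (P (X (\<sigma> \<omega>) \<omega>)) {\<omega>'\<in>space M. X s \<omega>' \<in> A}"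
  using assms unfolding hunt_process_def
  apply (elim conjE exE)
  subgoal premises prems for F
    apply (rule prems(1)[of F])
    subgoal by (rule prems)
    subgoal using prems(8) by (rule spec)
    subgoal using prems(9) by (rule spec)
    subgoal using prems(11) by (elim ballE allE impE) auto
    done
  done

lemma hunt_process_prob_space:
  assumes "hunt_process M X P"
  shows "prob_space (P x)" "sets (P x) = sets M"
  using measurable_space[OF hunt_process_kernel[OF assms], of x]
  by (auto simp: space_prob_algebra)

lemma hunt_process_measurable:
  assumes "hunt_process M X P"
  shows "X t \<in> M \<rightarrow>\<^sub>M cemetery_borel"
proof -
  obtain F where F: "filtration (space M) F" "\<And>t. sets (F t) \<subseteq> sets M"
    "\<And>t. X t \<in> F t \<rightarrow>\<^sub>M cemetery_borel"
    using assms by (rule hunt_process_strong_Markov) blast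
  then have "subalgebra M (F t)"
    by (simp add: subalgebra_def filtration.space_F)
  then show ?thesis
    using F(3) by (rule measurable_from_subalg)
qed

section \<open>Transition probabilities of a fixed Hunt process\<close>

locale hunt =
  fixes M :: "'w measure" and X :: "ennreal \<Rightarrow> 'w \<Rightarrow> 'a::{metric_space, second_countable_topology} option"
    and P :: "'a option \<Rightarrow> 'w measure"
  assumes hunt: "hunt_process M X P"
begin

sublocale P: prob_space "P x" for x
  using hunt by (rule hunt_process_prob_space)

lemmas sets_P [simp, measurable_cong] = hunt_process_prob_space(2)[OF hunt]

lemma space_P [simp]: "space (P x) = space M"
  by (rule sets_eq_imp_space_eq) simp

lemmas measurable_X [measurable] = hunt_process_measurable[OF hunt]

lemma not_cemetery_in_sets: "{\<omega>. X t \<omega> \<noteq> None} \<inter> space M \<in> sets M"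
proof -
  have "X t -` Some ` UNIV \<inter> space M \<in> sets M"
    by (rule measurable_sets[OF measurable_X Some_image_in_cemetery_borel]) simp
  also have "X t -` Some ` UNIV \<inter> space M = {\<omega>. X t \<omega> \<noteq> None} \<inter> space M"
    by auto
  finally show ?thesis .
qed

lemma measurable_the_X:
  "(\<lambda>\<omega>. the (X t \<omega>)) \<in> restrict_space (P x) {\<omega>. X t \<omega> \<noteq> None} \<rightarrow>\<^sub>M borel"
  by (rule measurable_compose[OF _ measurable_the_cemetery_borel], rule measurable_restrict_space3)
     (auto simp: measurable_X)

text \<open>Restricting the law to survival up to time \<open>t\<close> becomes an indicator, which
  masks the unspecified value \<open>the None\<close>.\<close>

lemma nn_integral_transition_prob:
  assumes "f \<in> borel_measurable borel"
  shows "(\<integral>\<^sup>+z. f z \<partial>transition_prob X P t x) =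
    (\<integral>\<^sup>+\<omega>. f (the (X (ennreal t) \<omega>)) * indicator {\<omega>. X (ennreal t) \<omega> \<noteq> None} \<omega> \<partial>P (Some x))"
  unfolding transition_prob_def
  using assms not_cemetery_in_sets
  by (subst nn_integral_distr[OF measurable_the_X]) (auto simp: nn_integral_restrict_space)

lemma emeasure_transition_prob:
  assumes "A \<in> sets borel"
  shows "emeasure (transition_prob X P t x) A =
    emeasure (P (Some x)) {\<omega>\<in>space M. X (ennreal t) \<omega> \<in> Some ` A}"
proof -
  have [measurable]: "{\<omega>\<in>space M. X (ennreal t) \<omega> \<in> Some ` A} \<in> sets M"
    using measurable_sets[OF measurable_X[of "ennreal t"] Some_image_in_cemetery_borel[OF assms]]
    by (simp add: vimage_def Int_def conj_commute)
  have "emeasure (transition_prob X P t x) A = (\<integral>\<^sup>+z. indicator A z \<partial>transition_prob X P t x)"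
    using assms by simp
  also have "\<dots> = (\<integral>\<^sup>+\<omega>. indicator {\<omega>\<in>space M. X (ennreal t) \<omega> \<in> Some ` A} \<omega> \<partial>P (Some x))"
  proof (subst nn_integral_transition_prob)
    show "(\<integral>\<^sup>+\<omega>. indicator A (the (X (ennreal t) \<omega>)) * indicator {\<omega>. X (ennreal t) \<omega> \<noteq> None} \<omega> \<partial>P (Some x))
      = (\<integral>\<^sup>+\<omega>. indicator {\<omega>\<in>space M. X (ennreal t) \<omega> \<in> Some ` A} \<omega> \<partial>P (Some x))"
      by (rule nn_integral_cong) (auto simp: indicator_def)
  qed (use assms in auto)
  also have "\<dots> = emeasure (P (Some x)) {\<omega>\<in>space M. X (ennreal t) \<omega> \<in> Some ` A}"
    by (rule nn_integral_indicator) simp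
  finally show ?thesis .
qed

lemma emeasure_transition_prob_le_1: "emeasure (transition_prob X P t x) A \<le> 1"
proof -
  have "emeasure (transition_prob X P t x) A \<le> emeasure (transition_prob X P t x) UNIV"
    using emeasure_space[of "transition_prob X P t x" A] by (simp add: transition_prob_def)
  also have "\<dots> \<le> 1"
    by (subst emeasure_transition_prob) (simp, rule P.measure_le_1)
  finally show ?thesis .
qed

lemma measurable_emeasure_transition_prob:
  assumes "A \<in> sets borel"
  shows "(\<lambda>z. emeasure (transition_prob X P t z) A) \<in> borel_measurable borel"
proof -
  have [measurable]: "{\<omega>\<in>space M. X (ennreal t) \<omega> \<in> Some ` A} \<in> sets M"
    using measurable_sets[OF measurable_X[of "ennreal t"] Some_image_in_cemetery_borel[OF assms]]
    by (simp add: vimage_def Int_def conj_commute)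
  have "P \<in> cemetery_borel \<rightarrow>\<^sub>M subprob_algebra M"
    using hunt_process_kernel[OF hunt] by (rule measurable_prob_algebraD)
  note [measurable] = measurable_compose[OF measurable_Some_cemetery_borel this]
  show ?thesis
    unfolding emeasure_transition_prob[OF assms] by measurable
qed

text \<open>This is the strong Markov property for the initial law concentrated at
  \<open>Some x\<close> and the constant stopping time \<open>t\<close>, integrated over all
  paths.\<close>

lemma Chapman_Kolmogorov_measure:
  assumes A: "A \<in> sets borel" and "0 \<le> s" "0 \<le> t"
  shows "emeasure (transition_prob X P (t + s) x) A =
    (\<integral>\<^sup>+z. emeasure (transition_prob X P s z) A \<partial>transition_prob X P t x)"
proof -
  define B where "B = {\<omega>\<in>space M. X (ennreal s) \<omega> \<in> Some ` A}"
  \<comment> \<open>The time has the form \<open>ennreal t + ennreal s\<close> demanded by the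
    Markov property; nonnegativity of both times later identifies it with
    \<open>ennreal (t + s)\<close>.\<close>
  define B' where "B' = {\<omega>\<in>space M. X (ennreal t + ennreal s) \<omega> \<in> Some ` A}"
  have A': "Some ` A \<in> sets cemetery_borel" using A by (rule Some_image_in_cemetery_borel)
  have sets_B [measurable]: "B \<in> sets M" "B' \<in> sets M"
    unfolding B_def B'_def
    using measurable_sets[OF measurable_X[of "ennreal s"] A']
      measurable_sets[OF measurable_X[of "ennreal t + ennreal s"] A']
    by (simp_all add: vimage_def Int_def conj_commute)
  obtain F where F: "filtration (space M) F" "\<And>t. sets (F t) \<subseteq> sets M"
    and Markov: "\<And>\<mu> \<sigma> s A. \<mu> \<in> space (prob_algebra cemetery_borel) \<Longrightarrow> stopping_time F \<sigma> \<Longrightarrow>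
       A \<in> sets cemetery_borel \<Longrightarrow>
       AE \<omega> in Giry_Monad.bind \<mu> P.
         real_cond_exp (Giry_Monad.bind \<mu> P) (filtration.pre_sigma (space M) F \<sigma>)
           (indicat_real {\<omega>'\<in>space M. X (\<sigma> \<omega>' + s) \<omega>' \<in> A}) \<omega>
         = measure (P (X (\<sigma> \<omega>) \<omega>)) {\<omega>'\<in>space M. X s \<omega>' \<in> A}"
    using hunt by (rule hunt_process_strong_Markov) blast
  let ?G = "filtration.pre_sigma (space M) F (\<lambda>_. ennreal t)"
  have meas_P: "P \<in> cemetery_borel \<rightarrow>\<^sub>M subprob_algebra M"
    using hunt_process_kernel[OF hunt] by (rule measurable_prob_algebraD)
  have bind: "Giry_Monad.bind (return cemetery_borel (Some x)) P = P (Some x)"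
    by (rule bind_return[OF meas_P]) simp
  \<comment> \<open>Conditional expectation on \<open>?G\<close> requires it to lie inside the
    sigma-algebra of \<open>P (Some x)\<close>. At the constant time \<open>t\<close> its sets
    belong to \<open>F t\<close>, hence to \<open>M\<close>.\<close>
  have "subalgebra (P (Some x)) ?G"
  proof -
    have "B \<in> sets M" if "B \<in> sets ?G" for B
      using filtration.sets_pre_sigmaD[OF F(1) stopping_time_const that, of "ennreal t"] F(2)
      by auto
    then show ?thesis
      by (auto simp: subalgebra_def filtration.space_pre_sigma[OF F(1)])
  qed
  then interpret finite_measure_subalgebra "P (Some x)" ?G
    by unfold_locales
  have "AE \<omega> in P (Some x). real_cond_exp (P (Some x)) ?G (indicat_real B') \<omega>
      = measure (P (X (ennreal t) \<omega>)) B"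
    using Markov[of "return cemetery_borel (Some x)" "\<lambda>_. ennreal t", OF _ stopping_time_const A', of "ennreal s"]
    unfolding bind B_def B'_def by (simp add: space_prob_algebra prob_space_return)
  moreover have meas_B: "(\<lambda>\<omega>. measure (P (X (ennreal t) \<omega>)) B) \<in> borel_measurable M"
    using meas_P by measurable
  \<comment> \<open>Integrating removes the conditioning: a conditional expectation has the same
    mean as the indicator of \<open>B'\<close>.\<close>
  ultimately have "(\<integral>\<omega>. measure (P (X (ennreal t) \<omega>)) B \<partial>P (Some x))
      = (\<integral>\<omega>. real_cond_exp (P (Some x)) ?G (indicat_real B') \<omega> \<partial>P (Some x))"
    by (intro integral_cong_AE) auto
  also have "\<dots> = measure (P (Some x)) B'"
    by (subst real_cond_exp_int(2)) (auto simp: less_top[symmetric])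
  finally have int: "(\<integral>\<omega>. measure (P (X (ennreal t) \<omega>)) B \<partial>P (Some x)) = measure (P (Some x)) B'" .
  have "emeasure (transition_prob X P (t + s) x) A = emeasure (P (Some x)) B'"
    using A assms by (simp add: emeasure_transition_prob B'_def ennreal_plus)
  also have "\<dots> = ennreal (\<integral>\<omega>. measure (P (X (ennreal t) \<omega>)) B \<partial>P (Some x))"
    by (simp add: int P.emeasure_eq_measure)
  also have "\<dots> = (\<integral>\<^sup>+\<omega>. emeasure (P (X (ennreal t) \<omega>)) B \<partial>P (Some x))"
    unfolding P.emeasure_eq_measure using meas_B
    by (intro nn_integral_eq_integral[symmetric] P.integrable_const_bound[where B=1]) auto
  also have "\<dots> = (\<integral>\<^sup>+\<omega>. emeasure (transition_prob X P s (the (X (ennreal t) \<omega>))) A *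
      indicator {\<omega>. X (ennreal t) \<omega> \<noteq> None} \<omega> \<partial>P (Some x))"
  \<comment> \<open>Paths started at the cemetery avoid \<open>B\<close> almost surely, so both
    sides vanish where \<open>X (ennreal t) \<omega> = None\<close>; elsewhere they are the same
    transition probability.\<close>
  proof (rule nn_integral_cong)
    fix \<omega>
    have "emeasure (P None) {\<omega>\<in>space (P None). \<omega> \<in> B} = 0"
      using hunt_process_cemetery[OF hunt, of "ennreal s"]
      by (intro emeasure_eq_0_AE) (auto simp: B_def elim!: eventually_mono)
    also have "{\<omega>\<in>space (P None). \<omega> \<in> B} = B" by (auto simp: B_def)
    finally have "emeasure (P None) B = 0" .
    then show "emeasure (P (X (ennreal t) \<omega>)) B = emeasure (transition_prob X P s (the (X (ennreal t) \<omega>))) A *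
      indicator {\<omega>. X (ennreal t) \<omega> \<noteq> None} \<omega>"
      by (cases "X (ennreal t) \<omega>") (auto simp: emeasure_transition_prob[OF A] B_def)
  qed
  also have "\<dots> = (\<integral>\<^sup>+z. emeasure (transition_prob X P s z) A \<partial>transition_prob X P t x)"
    by (rule nn_integral_transition_prob[symmetric]) (rule measurable_emeasure_transition_prob[OF A])
  finally show ?thesis .
qed

end


section \<open>Estimates on metric measure spaces\<close>

text \<open>At a point of continuity, \<open>f\<close> is within \<open>e / 2\<close> of
  \<open>f y\<close> on every small ball, hence so is its average. No covering theorem is
  involved.\<close>

lemma ball_average_tendsto:
  fixes f :: "'a::metric_space \<Rightarrow> real"
  assumes "finite_measure m" and sets_m: "sets m = sets borel"
    and "integrable m f" and "isCont f y" and pos: "\<And>n. 0 < measure m (ball y (1 / real (Suc n)))"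
  shows "(\<lambda>n. (\<integral>z. f z * indicator (ball y (1 / real (Suc n))) z \<partial>m) / measure m (ball y (1 / real (Suc n))))
    \<longlonglongrightarrow> f y"
proof (rule tendstoI)
  interpret finite_measure m by fact
  fix e :: real assume "0 < e"
  then obtain d where "0 < d" and d: "\<And>z. dist z y < d \<Longrightarrow> dist (f z) (f y) < e / 2"
    using \<open>isCont f y\<close> by (metis continuous_at_eps_delta half_gt_zero)
  from \<open>0 < d\<close> have "\<forall>\<^sub>F n in sequentially. 1 / real (Suc n) < d"
    using LIMSEQ_inverse_real_of_nat by (auto simp: inverse_eq_divide intro: order_tendstoD)
  then show "\<forall>\<^sub>F n in sequentially. dist ((\<integral>z. f z * indicator (ball y (1 / real (Suc n))) z \<partial>m) /
      measure m (ball y (1 / real (Suc n)))) (f y) < e"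
  proof eventually_elim
    case (elim n)
    let ?B = "ball y (1 / real (Suc n))"
    have B: "?B \<in> sets m" by (simp add: sets_m)
    have near: "f z \<le> f y + e / 2" "f y - e / 2 \<le> f z" if "z \<in> ?B" for z
    proof -
      have "\<bar>f z - f y\<bar> < e / 2"
        using d[of z] that elim by (simp add: dist_real_def dist_commute)
      then show "f z \<le> f y + e / 2" "f y - e / 2 \<le> f z" unfolding abs_less_iff by linarith+
    qed
    have f_B: "integrable m (\<lambda>z. f z * indicator ?B z)"
      using integrable_mult_indicator[OF B assms(3)] by (simp add: mult.commute)
    have c_B: "integrable m (\<lambda>z. c * indicator ?B z)" for c :: real
      using B by (intro integrable_mult_right integrable_real_indicator) (auto simp: less_top[symmetric])
    have "(\<integral>z. f z * indicator ?B z \<partial>m) \<le> (\<integral>z. (f y + e / 2) * indicator ?B z \<partial>m)"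
    proof (rule integral_mono[OF f_B c_B])
      show "f z * indicator ?B z \<le> (f y + e / 2) * indicator ?B z" for z
        by (cases "z \<in> ?B") (simp_all add: near del: mem_ball)
    qed
    moreover have "(\<integral>z. (f y - e / 2) * indicator ?B z \<partial>m) \<le> (\<integral>z. f z * indicator ?B z \<partial>m)"
    proof (rule integral_mono[OF c_B f_B])
      show "(f y - e / 2) * indicator ?B z \<le> f z * indicator ?B z" for z
        by (cases "z \<in> ?B") (simp_all add: near del: mem_ball)
    qed
    ultimately have "(f y - e / 2) * measure m ?B \<le> (\<integral>z. f z * indicator ?B z \<partial>m)"
      "(\<integral>z. f z * indicator ?B z \<partial>m) \<le> (f y + e / 2) * measure m ?B"
      using B by simp_all
    then have "f y - e / 2 \<le> (\<integral>z. f z * indicator ?B z \<partial>m) / measure m ?B"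
      "(\<integral>z. f z * indicator ?B z \<partial>m) / measure m ?B \<le> f y + e / 2"
      using pos[of n] by (simp_all add: field_simps)
    then show ?case using \<open>0 < e\<close> by (simp add: dist_real_def abs_less_iff)
  qed
qed

text \<open>Local compactness and second countability make the space sigma-compact; the complements
  of an increasing compact exhaustion shrink to the empty set, so their finite measures tend to
  0.\<close>

lemma compact_inner_approximation:
  fixes m :: "'a::{metric_space, second_countable_topology} measure"
  assumes "locally_compact_space (euclidean :: 'a topology)"
    and "finite_measure m" and sets_m: "sets m = sets borel" and "0 < \<epsilon>"
  obtains K where "compact K" "measure m (- K) < \<epsilon>"
proof -
  interpret finite_measure m by fact
  have "\<forall>x. \<exists>U K. open U \<and> compact K \<and> x \<in> U \<and> U \<subseteq> (K :: 'a set)"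
    using assms(1) by (auto simp: locally_compact_space_def)
  then obtain U K where UK: "\<And>x. open (U x)" "\<And>x. compact (K x)" "\<And>x. x \<in> U x" "\<And>x. U x \<subseteq> (K x :: 'a set)"
    by metis
  \<comment> \<open>Lindelof: countably many of the open sets \<open>U x\<close> already cover the
    space, and each lies in the compact set \<open>K x\<close>.\<close>
  obtain \<U> where \<U>: "\<U> \<subseteq> range U" "countable \<U>" "\<Union>\<U> = \<Union>(range U)"
    using Lindelof[of "range U"] UK(1) by (metis imageE)
  then obtain I where I: "countable I" "\<U> = U ` I"
    by (metis countable_subset_image)
  have cover: "\<Union>(U ` I) = UNIV"
    using \<U>(3) I(2) UK(3) by auto
  then have "I \<noteq> {}" by auto
  with I(1) have rng: "range (from_nat_into I) = I" by simp
  define L where "L n = (\<Union>i\<le>n. K (from_nat_into I i))" for n :: nat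
  have compact_L: "compact (L n)" for n
    unfolding L_def using UK(2) by auto
  have "x \<in> (\<Union>n. L n)" for x
  proof -
    obtain j where "j \<in> I" "x \<in> U j" using cover by blast
    then obtain i where "x \<in> U (from_nat_into I i)" using rng by (metis imageE)
    then have "x \<in> L i" using UK(4) by (auto simp: L_def)
    then show ?thesis by blast
  qed
  then have "(\<Inter>n. - L n) = {}" by blast
  moreover have "decseq (\<lambda>n. - L n)"
    by (force simp: decseq_def L_def)
  moreover have "- L n \<in> sets m" for n
    using compact_L[of n] by (auto simp: sets_m intro!: borel_open open_Compl compact_imp_closed)
  ultimately have "(\<lambda>n. measure m (- L n)) \<longlonglongrightarrow> 0"
    using finite_Lim_measure_decseq[of "\<lambda>n. - L n"] by (auto simp: image_subset_iff)
  then have "\<forall>\<^sub>F n in sequentially. measure m (- L n) < \<epsilon>"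
    using \<open>0 < \<epsilon>\<close> by (rule order_tendstoD)
  then obtain n where "measure m (- L n) < \<epsilon>"
    using eventually_happens'[OF sequentially_bot] by blast
  with compact_L show ?thesis by (rule that)
qed

section \<open>Elementary integrals and the exponential against powers\<close>

lemma nn_integral_exp_minus: "(\<integral>\<^sup>+t\<in>{0<..}. ennreal (exp (- t)) \<partial>lborel) \<le> 1"
proof -
  have "(\<integral>\<^sup>+t\<in>{0<..}. ennreal (exp (- t)) \<partial>lborel) \<le> (\<integral>\<^sup>+t\<in>{0..}. ennreal (t ^ 0 * exp (- t)) \<partial>lborel)"
    by (intro nn_integral_mono) (auto simp: indicator_def)
  also have "\<dots> = 1"
    by (subst nn_intergal_power_times_exp_Ici) simp
  finally show ?thesis .
qed

lemma nn_integral_powr_le: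
  fixes e \<delta> :: real
  assumes "- 1 < e" "0 \<le> \<delta>"
  shows "(\<integral>\<^sup>+t\<in>{0<..\<delta>}. ennreal (t powr e) \<partial>lborel) \<le> ennreal (\<delta> powr (e + 1) / (e + 1))"
proof -
  have "(\<integral>\<^sup>+t\<in>{0<..\<delta>}. ennreal (t powr e) \<partial>lborel) \<le> (\<integral>\<^sup>+t. ennreal (indicator {0..\<delta>} t * t powr e) \<partial>lborel)"
    by (intro nn_integral_mono) (auto simp: indicator_def)
  also have "\<dots> = ennreal (\<delta> powr (e + 1) / (e + 1))"
    using nn_integral_has_integral_lebesgue[OF _ has_integral_powr_from_0[OF assms]]
    by (simp add: nn_integral_completion)
  finally show ?thesis .
qed

text \<open>Raise \<open>c * w / j \<le> exp (c * w / j)\<close> to the power \<open>j\<close> and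
  take reciprocals.\<close>

lemma exp_minus_le_powr:
  fixes w c j :: real
  assumes "0 < w" "0 < c" "0 < j"
  shows "exp (- (c * w)) \<le> (j / c) powr j * w powr (- j)"
proof -
  have "c * w / j \<le> exp (c * w / j)"
    using exp_ge_add_one_self[of "c * w / j"] by linarith
  then have "(c * w / j) powr j \<le> exp (c * w / j) powr j"
    using assms by (intro powr_mono2) auto
  also have "\<dots> = exp (c * w)"
    using assms by (simp add: powr_def)
  finally have "(c / j) powr j * w powr j \<le> exp (c * w)"
    using assms by (simp add: powr_mult[symmetric])
  then show ?thesis
    using assms by (simp add: exp_minus powr_minus powr_divide field_simps)
qed

text \<open>Decompose the unit ball into dyadic annuli around \<open>x\<close>. On the n-th one the
  integrand is at most a constant times 2^(n s), while the measure is at most \<open>c\<close> times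
  2^(-n d); since \<open>s < d\<close> the sum is geometric, and its value does not depend on
  \<open>x\<close>.\<close>

lemma nn_integral_dist_powr_le:
  fixes m :: "'a::metric_space measure" and s d c :: real
  assumes "finite_measure m" and sets_m: "sets m = sets borel" and "0 < s" "s < d" "0 \<le> c"
    and ball_le: "\<And>x r. 0 < r \<Longrightarrow> r \<le> 1 \<Longrightarrow> measure m (ball x r) \<le> c * r powr d"
  obtains I where "0 \<le> I" "\<And>x. (\<integral>\<^sup>+y. ennreal (dist x y powr (- s)) \<partial>m) \<le> ennreal I"
proof -
  interpret finite_measure m by fact
  define \<theta> where "\<theta> = (1 / 2 :: real) powr (d - s)"
  define I where "I = measure m UNIV + 2 powr s * c / (1 - \<theta>)"
  have \<theta>: "0 < \<theta>" "\<theta> < 1"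
    using \<open>s < d\<close> by (auto simp: \<theta>_def powr01_less_one)
  have "0 \<le> I" using \<theta> \<open>0 \<le> c\<close> by (simp add: I_def)
  have [measurable]: "ball x r \<in> sets m" for x r by (simp add: sets_m)
  \<comment> \<open>Each annulus is enlarged to the full ball, which only increases the bound and
    allows the volume estimate to be applied directly.\<close>
  define h where "h x y n = ennreal (((1/2) ^ Suc n) powr (- s)) * indicator (ball x ((1/2) ^ n)) y" for x y :: 'a and n :: nat
  have [measurable]: "(\<lambda>y. h x y n) \<in> borel_measurable m" for x n
    unfolding h_def by measurable
  have pointwise: "ennreal (dist x y powr (- s)) \<le> 1 + (\<Sum>n. h x y n)" for x y
  \<comment> \<open>Here the summand 1 suffices: at \<open>x = y\<close> the convention
    \<open>0 powr _ = 0\<close> applies, and at distance at least 1 a negative power is at most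
    1.\<close>
  proof (cases "x = y \<or> 1 \<le> dist x y")
    case True
    then have "dist x y powr (- s) \<le> 1"
      using \<open>0 < s\<close> powr_mono2'[of "- s" 1 "dist x y"] by auto
    then have "ennreal (dist x y powr (- s)) \<le> 1" by simp
    then show ?thesis by (rule order_trans) simp
  next
    case False
    \<comment> \<open>The annulus containing \<open>y\<close> is found from the least
      \<open>k\<close> with \<open>(1/2) ^ k \<le> dist x y\<close>; it is not 0 because the
      distance is below 1.\<close>
    then have "\<exists>n. (1/2) ^ n \<le> dist x y"
      using real_arch_pow_inv[of "dist x y" "1/2"] by (auto intro: less_imp_le)
    then obtain k where k: "(1/2) ^ k \<le> dist x y" "\<And>i. i < k \<Longrightarrow> \<not> (1/2) ^ i \<le> dist x y"
      using exists_least_iff[of "\<lambda>n. (1/2) ^ n \<le> dist x y"] by blast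
    moreover have "k \<noteq> 0" using k(1) False by (cases k) auto
    then obtain n where "k = Suc n" by (cases k) auto
    ultimately have n: "(1/2) ^ Suc n \<le> dist x y" "dist x y < (1/2) ^ n" by (auto simp: not_le)
    have "dist x y powr (- s) \<le> ((1/2) ^ Suc n) powr (- s)"
      using n(1) \<open>0 < s\<close> by (intro powr_mono2') auto
    then have "ennreal (dist x y powr (- s)) \<le> h x y n"
      using n(2) by (simp add: h_def ennreal_leI)
    also have "\<dots> \<le> (\<Sum>n. h x y n)"
      using sum_le_suminf[of "h x y" "{n}"] by simp
    also have "\<dots> \<le> 1 + (\<Sum>n. h x y n)" by simp
    finally show ?thesis .
  qed
  have "(\<integral>\<^sup>+y. ennreal (dist x y powr (- s)) \<partial>m) \<le> ennreal I" for x
  proof -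
    have "(\<integral>\<^sup>+y. ennreal (dist x y powr (- s)) \<partial>m) \<le> (\<integral>\<^sup>+y. 1 + (\<Sum>n. h x y n) \<partial>m)"
      by (intro nn_integral_mono pointwise)
    also have "\<dots> = emeasure m (space m) + (\<Sum>n. \<integral>\<^sup>+y. h x y n \<partial>m)"
      by (subst nn_integral_add) (measurable, simp add: nn_integral_suminf)
    also have "(\<Sum>n. \<integral>\<^sup>+y. h x y n \<partial>m) \<le> (\<Sum>n. ennreal (2 powr s * c * \<theta> ^ n))"
    proof (rule suminf_le)
      fix n :: nat
      have "(\<integral>\<^sup>+y. h x y n \<partial>m) = ennreal (((1/2) ^ Suc n) powr (- s) * measure m (ball x ((1/2) ^ n)))"
        by (simp add: h_def nn_integral_cmult emeasure_eq_measure ennreal_mult)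
      also have "\<dots> \<le> ennreal (((1/2) ^ Suc n) powr (- s) * (c * ((1/2) ^ n) powr d))"
        by (intro ennreal_leI mult_left_mono ball_le) (auto simp: power_le_one)
      also have "((1/2) ^ Suc n) powr (- s) * (c * ((1/2) ^ n) powr d) = 2 powr s * c * \<theta> ^ n"
      proof -
        have "((1/2 :: real) ^ Suc n) powr (- s) = 2 powr s * (1/2) powr (- s * real n)"
          unfolding power_Suc powr_mult
          by (simp add: powr_minus powr_divide powr_realpow[symmetric] powr_powr mult.commute)
        moreover have "((1/2 :: real) ^ n) powr d = (1/2) powr (d * real n)"
          by (simp add: powr_realpow[symmetric] powr_powr mult.commute)
        moreover have "\<theta> ^ n = (1/2) powr (- s * real n) * (1/2) powr (d * real n)"
          by (simp add: \<theta>_def powr_realpow[symmetric] powr_powr powr_add[symmetric] algebra_simps)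
        ultimately show ?thesis by simp
      qed
      finally show "(\<integral>\<^sup>+y. h x y n \<partial>m) \<le> ennreal (2 powr s * c * \<theta> ^ n)" .
    qed auto
    also have "(\<Sum>n. ennreal (2 powr s * c * \<theta> ^ n)) = ennreal (2 powr s * c * (1 / (1 - \<theta>)))"
      using \<theta> \<open>0 \<le> c\<close> by (intro suminf_ennreal_eq sums_mult geometric_sums) auto
    also have "emeasure m (space m) + ennreal (2 powr s * c * (1 / (1 - \<theta>))) = ennreal I"
      using \<theta> \<open>0 \<le> c\<close> sets_eq_imp_space_eq[OF sets_m] by (simp add: I_def emeasure_eq_measure ennreal_plus)
    finally show ?thesis by (simp add: add_left_mono)
  qed
  with \<open>0 \<le> I\<close> show ?thesis by (rule that)
qed

text \<open>The singleton lies in every ball around \<open>x\<close>, whose measure tends to 0 with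
  the radius.\<close>

lemma emeasure_singleton_eq_0:
  fixes m :: "'a::metric_space measure" and d c :: real
  assumes "finite_measure m" and sets_m: "sets m = sets borel" and "0 < d"
    and ball_le: "\<And>r. 0 < r \<Longrightarrow> r \<le> 1 \<Longrightarrow> measure m (ball x r) \<le> c * r powr d"
  shows "emeasure m {x} = 0"
proof -
  interpret finite_measure m by fact
  have "measure m {x} \<le> 0"
  proof (rule tendsto_lowerbound)
    show "((\<lambda>r. c * r powr d) \<longlongrightarrow> 0) (at_right 0)"
      using \<open>0 < d\<close> by real_asymp
    have "\<forall>\<^sub>F r in at_right 0. (0::real) < r \<and> r \<le> 1"
      by (auto simp: eventually_at_right_field intro!: exI[of _ 1])
    then show "\<forall>\<^sub>F r in at_right 0. measure m {x} \<le> c * r powr d"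
    proof eventually_elim
      case (elim r)
      have "measure m {x} \<le> measure m (ball x r)"
        using elim by (intro finite_measure_mono) (auto simp: sets_m)
      also have "\<dots> \<le> c * r powr d" using elim by (intro ball_le) auto
      finally show ?case .
    qed
  qed simp
  then show ?thesis by (simp add: emeasure_eq_measure measure_le_0_iff)
qed

text \<open>Trades exponential decay for a power, with \<open>k\<close> free. The exponent
  \<open>j = k * (\<beta> - 1)\<close> is chosen to cancel the root
  \<open>1 / (\<beta> - 1)\<close>, leaving \<open>(d powr \<beta> / t) powr (- k)\<close>.\<close>

lemma sub_gaussian_le_powr:
  fixes a c c' d k t \<beta> :: real
  assumes "0 < t" "0 < d" "0 < c" "0 < c'" "0 < k" "1 < \<beta>"
  shows "c * t powr (- a) * exp (- (c' * (d powr \<beta> / t) powr (1 / (\<beta> - 1))))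
    \<le> c * ((k * (\<beta> - 1)) / c') powr (k * (\<beta> - 1)) * t powr (k - a) * d powr (- (k * \<beta>))"
proof -
  define j where "j = k * (\<beta> - 1)"
  have "0 < j" using assms by (simp add: j_def)
  have "exp (- (c' * (d powr \<beta> / t) powr (1 / (\<beta> - 1))))
      \<le> (j / c') powr j * ((d powr \<beta> / t) powr (1 / (\<beta> - 1))) powr (- j)"
    using assms \<open>0 < j\<close> by (intro exp_minus_le_powr) auto
  also have "((d powr \<beta> / t) powr (1 / (\<beta> - 1))) powr (- j) = (d powr \<beta> / t) powr (- k)"
    using assms by (simp add: powr_powr j_def)
  also have "\<dots> = d powr (- (k * \<beta>)) * t powr k"
    using assms by (simp add: powr_divide powr_powr powr_minus field_simps)
  finally have "c * t powr (- a) * exp (- (c' * (d powr \<beta> / t) powr (1 / (\<beta> - 1))))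
      \<le> c * t powr (- a) * ((j / c') powr j * (d powr (- (k * \<beta>)) * t powr k))"
    using assms by (intro mult_left_mono) auto
  also have "\<dots> = c * (j / c') powr j * (t powr (- a) * t powr k) * d powr (- (k * \<beta>))"
    by (simp only: mult_ac)
  also have "t powr (- a) * t powr k = t powr (k - a)"
    by (simp add: powr_add[symmetric])
  finally show ?thesis by (simp only: j_def)
qed


section \<open>Heat kernels\<close>

text \<open>Collects the analytic facts used about the process, so that everything below is free of
  paths. Measurability in the starting point is required only for the measure of a fixed
  set.\<close>

locale heat_kernel = finite_measure m
  for m :: "'a::{metric_space, second_countable_topology} measure" +
  fixes Q :: "real \<Rightarrow> 'a \<Rightarrow> 'a measure" and q :: "real \<Rightarrow> 'a \<Rightarrow> 'a \<Rightarrow> real"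
  assumes sets_m [simp, measurable_cong]: "sets m = sets borel"
    and ball_pos: "0 < r \<Longrightarrow> 0 < measure m (ball x r)"
    and density: "transition_density m Q q"
    and subprob: "0 < t \<Longrightarrow> emeasure (Q t x) UNIV \<le> 1"
    and measurable_Q: "0 < t \<Longrightarrow> A \<in> sets borel \<Longrightarrow> (\<lambda>z. emeasure (Q t z) A) \<in> borel_measurable borel"
    and Chapman_Kolmogorov: "0 < s \<Longrightarrow> 0 < t \<Longrightarrow> A \<in> sets borel \<Longrightarrow>
      emeasure (Q (t + s) x) A = (\<integral>\<^sup>+z. emeasure (Q s z) A \<partial>Q t x)"
    and continuous_right: "0 < t \<Longrightarrow> continuous_on UNIV (\<lambda>y. q t x y)"
    and continuous_left: "0 < t \<Longrightarrow> continuous_on UNIV (\<lambda>x. q t x y)"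
begin

section \<open>The density and its Chapman-Kolmogorov equation\<close>

lemma space_m [simp]: "space m = UNIV"
  using sets_eq_imp_space_eq[OF sets_m] by simp

lemma q_nonneg: "0 < t \<Longrightarrow> 0 \<le> q t x y"
  using density by (simp add: transition_density_def)

lemma Q_eq_density: "0 < t \<Longrightarrow> Q t x = density m (\<lambda>y. ennreal (q t x y))"
  using density by (simp add: transition_density_def)

lemma q_right_measurable [measurable]: "0 < t \<Longrightarrow> q t x \<in> borel_measurable borel"
  using density by (simp add: transition_density_def)

lemma q_left_measurable: "0 < t \<Longrightarrow> (\<lambda>x. q t x y) \<in> borel_measurable borel"
  using continuous_left by (rule borel_measurable_continuous_onI)

lemma finite_measure_Q: "0 < t \<Longrightarrow> finite_measure (Q t x)"
  using subprob[of t x] by (intro finite_measureI) (auto simp: Q_eq_density top_unique)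

lemma integrable_q: "0 < t \<Longrightarrow> integrable m (q t x)"
proof (rule integrableI_bounded)
  assume "0 < t"
  then have "(\<integral>\<^sup>+ y. ennreal (norm (q t x y)) \<partial>m) = emeasure (Q t x) UNIV"
    by (simp add: Q_eq_density q_nonneg emeasure_density)
  also have "\<dots> < \<infinity>"
    using subprob[OF \<open>0 < t\<close>, of x] by (auto simp: less_top[symmetric] top_unique)
  finally show "(\<integral>\<^sup>+ y. ennreal (norm (q t x y)) \<partial>m) < \<infinity>" .
qed simp

lemma measure_Q:
  assumes "0 < t" "A \<in> sets borel"
  shows "measure (Q t x) A = (\<integral>y. q t x y * indicator A y \<partial>m)"
proof -
  have "ennreal (measure (Q t x) A) = (\<integral>\<^sup>+y. ennreal (q t x y) * indicator A y \<partial>m)"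
    using assms finite_measure.emeasure_eq_measure[OF finite_measure_Q[OF assms(1)], of x A]
    by (simp add: Q_eq_density emeasure_density)
  also have "\<dots> = (\<integral>\<^sup>+y. ennreal (q t x y * indicator A y) \<partial>m)"
    by (rule nn_integral_cong) (simp add: indicator_def)
  also have "\<dots> = ennreal (\<integral>y. q t x y * indicator A y \<partial>m)"
    using assms integrable_mult_indicator[of A m "q t x"]
    by (intro nn_integral_eq_integral) (auto simp: integrable_q q_nonneg mult.commute)
  finally show ?thesis
    by (subst (asm) ennreal_inj) (auto intro!: integral_nonneg_AE simp: q_nonneg assms)
qed

text \<open>Apply the equation for measures to balls \<open>B n\<close> shrinking to
  \<open>y\<close> and divide by their volume. Averages of \<open>q s z\<close> inherit the bound
  \<open>C\<close>, so dominated convergence passes to the limit under the integral.\<close>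

lemma Chapman_Kolmogorov_density:
  assumes s: "0 < s" and t: "0 < t" and bound: "\<And>x y. q s x y \<le> C"
  shows "q (t + s) x y = (\<integral>z. q t x z * q s z y \<partial>m)"
proof -
  define B where "B n = ball y (1 / real (Suc n))" for n
  have B [simp]: "B n \<in> sets borel" for n by (simp add: B_def)
  have B_pos: "0 < measure m (B n)" for n by (simp add: B_def ball_pos)
  have "0 \<le> C" using q_nonneg[OF s] bound by (rule order_trans)
  have average: "(\<lambda>n. measure (Q u x) (B n) / measure m (B n)) \<longlonglongrightarrow> q u x y" if "0 < u" for u x
    using ball_average_tendsto[OF finite_measure_axioms sets_m integrable_q[OF that], of y x] that
      continuous_right[OF that, of x] ball_pos
    by (simp add: measure_Q B_def continuous_on_eq_continuous_at)
  have average_nonneg: "0 \<le> measure (Q s z) (B n) / measure m (B n)" for z n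
    by simp
  have average_le: "measure (Q s z) (B n) / measure m (B n) \<le> C" for z n
  proof -
    have "measure (Q s z) (B n) \<le> (\<integral>y. C * indicator (B n) y \<partial>m)"
      unfolding measure_Q[OF s B]
    proof (rule integral_mono)
      show "integrable m (\<lambda>y. q s z y * indicator (B n) y)"
        using integrable_mult_indicator[of "B n" m "q s z"] by (simp add: integrable_q s mult.commute)
      show "integrable m (\<lambda>y. C * indicator (B n) y)"
        by (intro integrable_mult_right integrable_real_indicator) (auto simp: less_top[symmetric])
    qed (simp add: bound mult_right_mono)
    then show ?thesis using B_pos[of n] by (simp add: divide_le_eq)
  qed
  have [measurable]: "(\<lambda>z. measure (Q s z) (B n)) \<in> borel_measurable borel" for n
    using measurable_Q[OF s B] by (simp add: measure_def)
  have [measurable]: "q t x \<in> borel_measurable borel" "(\<lambda>z. q s z y) \<in> borel_measurable borel"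
    using s t by (simp_all add: q_left_measurable)
  \<comment> \<open>The averaged equation for fixed \<open>n\<close>. Integrability is settled
    first, so that the nonnegative integral becomes a real one and the volume factor
    cancels.\<close>
  have eq: "measure (Q (t + s) x) (B n) / measure m (B n) =
      (\<integral>z. q t x z * (measure (Q s z) (B n) / measure m (B n)) \<partial>m)" for n
  proof -
    have "integrable m (\<lambda>z. q t x z * (measure (Q s z) (B n) / measure m (B n)))"
    proof (rule Bochner_Integration.integrable_bound)
      show "integrable m (\<lambda>z. q t x z * C)" using t by (simp add: integrable_q)
      show "AE z in m. norm (q t x z * (measure (Q s z) (B n) / measure m (B n))) \<le> norm (q t x z * C)"
        using average_le average_nonneg q_nonneg[OF t] \<open>0 \<le> C\<close>
        by (intro AE_I2) (simp add: abs_mult mult_left_mono del: times_divide_eq_right)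
    qed measurable
    then have "integrable m (\<lambda>z. measure m (B n) * (q t x z * (measure (Q s z) (B n) / measure m (B n))))"
      by (rule integrable_mult_right)
    moreover have "measure m (B n) * (q t x z * (measure (Q s z) (B n) / measure m (B n)))
        = q t x z * measure (Q s z) (B n)" for z
      using less_imp_neq[OF B_pos[of n]] by simp
    ultimately have int: "integrable m (\<lambda>z. q t x z * measure (Q s z) (B n))"
      by (simp only:)
    have "ennreal (measure (Q (t + s) x) (B n)) = emeasure (Q (t + s) x) (B n)"
      using s t finite_measure.emeasure_eq_measure[OF finite_measure_Q] by simp
    also have "\<dots> = (\<integral>\<^sup>+z. emeasure (Q s z) (B n) \<partial>Q t x)"
      using s t by (simp add: Chapman_Kolmogorov)
    also have "\<dots> = (\<integral>\<^sup>+z. ennreal (q t x z * measure (Q s z) (B n)) \<partial>m)"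
      using s t finite_measure.emeasure_eq_measure[OF finite_measure_Q]
      by (simp add: Q_eq_density[OF t] nn_integral_density ennreal_mult q_nonneg)
    also have "\<dots> = ennreal (\<integral>z. q t x z * measure (Q s z) (B n) \<partial>m)"
      using int t by (intro nn_integral_eq_integral) (auto simp: q_nonneg)
    finally have "measure (Q (t + s) x) (B n) = (\<integral>z. q t x z * measure (Q s z) (B n) \<partial>m)"
      by (subst (asm) ennreal_inj) (auto intro!: integral_nonneg_AE simp: q_nonneg t)
    then show ?thesis by simp
  qed
  \<comment> \<open>The integrands converge by continuity of \<open>q s z\<close> at
    \<open>y\<close>, under the integrable majorant \<open>q t x z * C\<close>.\<close>
  have "(\<lambda>n. \<integral>z. q t x z * (measure (Q s z) (B n) / measure m (B n)) \<partial>m)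
      \<longlonglongrightarrow> (\<integral>z. q t x z * q s z y \<partial>m)"
  proof (rule integral_dominated_convergence)
    show "integrable m (\<lambda>z. q t x z * C)" using t by (simp add: integrable_q)
    show "AE z in m. (\<lambda>n. q t x z * (measure (Q s z) (B n) / measure m (B n))) \<longlonglongrightarrow> q t x z * q s z y"
      using average[OF s] by (intro AE_I2 tendsto_mult tendsto_const) simp
    show "AE z in m. norm (q t x z * (measure (Q s z) (B n) / measure m (B n))) \<le> q t x z * C" for n
      using average_le average_nonneg q_nonneg[OF t] \<open>0 \<le> C\<close>
      by (intro AE_I2) (simp add: abs_mult mult_left_mono del: times_divide_eq_right)
  qed measurable
  moreover have "(\<lambda>n. \<integral>z. q t x z * (measure (Q s z) (B n) / measure m (B n)) \<partial>m) \<longlonglongrightarrow> q (t + s) x y"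
    unfolding eq[symmetric] using s t by (intro average) simp
  ultimately show ?thesis by (rule LIMSEQ_unique[THEN sym])
qed

section \<open>Uniform bounds and joint continuity\<close>

lemma q_mono_bound:
  assumes "0 < s" "0 < t" "\<And>x y. q s x y \<le> C"
  shows "q (t + s) x y \<le> C"
proof -
  have "0 \<le> C" using q_nonneg[OF assms(1)] assms(3) by (rule order_trans)
  have "q (t + s) x y \<le> (\<integral>z. q t x z * C \<partial>m)"
    unfolding Chapman_Kolmogorov_density[OF assms] using assms \<open>0 \<le> C\<close> q_nonneg
    by (intro integral_mono_AE' AE_I2) (auto simp: integrable_q intro!: mult_left_mono)
  also have "\<dots> = measure (Q t x) UNIV * C"
    using assms by (simp add: measure_Q)
  also have "\<dots> \<le> 1 * C"
    using subprob[OF assms(2), of x] \<open>0 \<le> C\<close>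
      finite_measure.emeasure_eq_measure[OF finite_measure_Q[OF assms(2)], of x UNIV]
    by (intro mult_right_mono) auto
  finally show ?thesis by simp
qed

text \<open>Splitting \<open>t\<close> into two halves separates the variables: \<open>x\<close> and
  \<open>y\<close> enter different factors, each continuous on its own. The constant majorant
  \<open>C * C\<close> is integrable because \<open>m\<close> is finite.\<close>

lemma jointly_continuous:
  assumes "0 < t" "\<And>x y. q (t / 2) x y \<le> C"
  shows "continuous_on UNIV (\<lambda>(x, y). q t x y)"
proof (rule continuous_on_sequentiallyI)
  fix u :: "nat \<Rightarrow> 'a \<times> 'a" and w assume lim: "u \<longlonglongrightarrow> w"
  have t2: "0 < t / 2" using assms by simp
  have [measurable]: "q (t / 2) x \<in> borel_measurable borel" "(\<lambda>z. q (t / 2) z y) \<in> borel_measurable borel" for x y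
    using t2 by (simp_all add: q_left_measurable)
  have factor: "q t x y = (\<integral>z. q (t / 2) x z * q (t / 2) z y \<partial>m)" for x y
    using Chapman_Kolmogorov_density[OF t2 t2 assms(2), of x y] by simp
  have "0 \<le> C" using q_nonneg[OF t2] assms(2) by (rule order_trans)
  have "(\<lambda>n. \<integral>z. q (t / 2) (fst (u n)) z * q (t / 2) z (snd (u n)) \<partial>m)
      \<longlonglongrightarrow> (\<integral>z. q (t / 2) (fst w) z * q (t / 2) z (snd w) \<partial>m)"
  proof (rule integral_dominated_convergence)
    show "AE z in m. (\<lambda>n. q (t / 2) (fst (u n)) z * q (t / 2) z (snd (u n)))
        \<longlonglongrightarrow> q (t / 2) (fst w) z * q (t / 2) z (snd w)"
      by (intro AE_I2 tendsto_mult continuous_on_tendsto_compose[OF continuous_left[OF t2]]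
          continuous_on_tendsto_compose[OF continuous_right[OF t2]] tendsto_fst tendsto_snd lim) auto
    show "AE z in m. norm (q (t / 2) (fst (u n)) z * q (t / 2) z (snd (u n))) \<le> C * C" for n
      using assms(2) \<open>0 \<le> C\<close> q_nonneg[OF t2] by (intro AE_I2) (simp add: abs_mult mult_mono)
  qed auto
  then show "(\<lambda>n. case u n of (x, y) \<Rightarrow> q t x y) \<longlonglongrightarrow> (case w of (x, y) \<Rightarrow> q t x y)"
    by (simp add: factor case_prod_beta)
qed

text \<open>The short-time bound covers \<open>t \<le> 1\<close>. For larger \<open>t\<close>, write
  \<open>t = (t - 1) + 1\<close>: the uniform bound at time 1 persists since the kernel is
  sub-Markovian.\<close>

lemma bounded_away_from_0:
  assumes "0 \<le> c" "0 \<le> a" and bound: "\<And>t x y. 0 < t \<Longrightarrow> t \<le> 1 \<Longrightarrow> q t x y \<le> c * t powr (- a)"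
    and "0 < \<delta>" "\<delta> \<le> 1" "\<delta> \<le> t"
  shows "q t x y \<le> c * \<delta> powr (- a)"
proof (cases "t \<le> 1")
  case True
  have "0 < t" using assms(4,6) by simp
  then have "q t x y \<le> c * t powr (- a)" using True by (rule bound)
  also have "t powr (- a) \<le> \<delta> powr (- a)"
    using assms(2,4,6) by (intro powr_mono2') auto
  finally show ?thesis using \<open>0 \<le> c\<close> by (simp add: mult_left_mono)
next
  case False
  have "q 1 x y \<le> c" for x y
    using bound[of 1 x y] by simp
  then have "q (t - 1 + 1) x y \<le> c"
    using False by (intro q_mono_bound) auto
  then have "q t x y \<le> c * 1" by simp
  also have "1 \<le> \<delta> powr (- a)"
    using powr_mono2'[of "- a" \<delta> 1] assms(2,4,5) by simp
  finally show ?thesis using \<open>0 \<le> c\<close> by (simp add: mult_left_mono)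
qed

section \<open>The parts of Assumption (A) for a heat kernel\<close>

lemma assumption_A2_if:
  assumes "\<And>t. 0 < t \<Longrightarrow> \<exists>C. \<forall>x y. q t x y \<le> C"
  shows "assumption_A2 m Q q"
proof -
  have "continuous_on UNIV (\<lambda>(x, y). q t x y)" if "0 < t" for t
    using assms[of "t / 2"] that jointly_continuous by (metis half_gt_zero)
  then show ?thesis
    using assms density unfolding assumption_A2_def
    by (auto simp: Q_eq_density absolutely_continuousI_density)
qed

lemma semigroup_op_eq:
  assumes "0 < t" "f \<in> borel_measurable m"
  shows "semigroup_op Q t f x = (\<integral>y. q t x y * f y \<partial>m)"
  unfolding semigroup_op_def Q_eq_density[OF assms(1)] using assms
  by (subst integral_density) (auto simp: q_nonneg)

text \<open>Supplies the measurability required to bound the essential supremum in the operator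
  norm.\<close>

lemma continuous_semigroup_op:
  assumes t: "0 < t" and f: "integrable m f" and bound: "\<And>x y. q t x y \<le> C"
  shows "continuous_on UNIV (semigroup_op Q t f)"
proof (rule continuous_on_sequentiallyI)
  fix u :: "nat \<Rightarrow> 'a" and x assume lim: "u \<longlonglongrightarrow> x"
  have [measurable]: "f \<in> borel_measurable m" "q t x \<in> borel_measurable borel" for x
    using f t by auto
  have "(\<lambda>n. \<integral>y. q t (u n) y * f y \<partial>m) \<longlonglongrightarrow> (\<integral>y. q t x y * f y \<partial>m)"
  proof (rule integral_dominated_convergence)
    show "integrable m (\<lambda>y. C * \<bar>f y\<bar>)" using f by simp
    show "AE y in m. (\<lambda>n. q t (u n) y * f y) \<longlonglongrightarrow> q t x y * f y"
      by (intro AE_I2 tendsto_mult tendsto_const continuous_on_tendsto_compose[OF continuous_left[OF t]] lim) auto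
    show "AE y in m. norm (q t (u n) y * f y) \<le> C * \<bar>f y\<bar>" for n
      using bound q_nonneg[OF t] by (intro AE_I2) (simp add: abs_mult mult_right_mono)
  qed auto
  then show "(\<lambda>n. semigroup_op Q t f (u n)) \<longlonglongrightarrow> semigroup_op Q t f x"
    by (simp add: semigroup_op_eq t)
qed

lemma norm_L1_Linf_le:
  assumes t: "0 < t" and bound: "\<And>x y. q t x y \<le> C"
  shows "norm_L1_Linf m (semigroup_op Q t) \<le> ennreal C"
  unfolding norm_L1_Linf_def
proof (rule SUP_least, clarify)
  fix f :: "'a \<Rightarrow> real" assume f: "integrable m f" "(\<integral>x. \<bar>f x\<bar> \<partial>m) \<le> 1"
  have "0 \<le> C" using q_nonneg[OF t] bound by (rule order_trans)
  have [measurable]: "f \<in> borel_measurable m" "q t x \<in> borel_measurable borel" for x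
    using f t by auto
  have "\<bar>semigroup_op Q t f x\<bar> \<le> C" for x
  proof -
    have "\<bar>semigroup_op Q t f x\<bar> \<le> (\<integral>y. \<bar>q t x y * f y\<bar> \<partial>m)"
      unfolding semigroup_op_eq[OF t borel_measurable_integrable[OF f(1)]] by (rule integral_abs_bound)
    also have "\<dots> \<le> (\<integral>y. C * \<bar>f y\<bar> \<partial>m)"
      using f bound q_nonneg[OF t] \<open>0 \<le> C\<close>
      by (intro integral_mono_AE' AE_I2) (auto simp: abs_mult intro!: mult_right_mono)
    also have "\<dots> \<le> C" using f \<open>0 \<le> C\<close> by (simp add: mult_left_le)
    finally show ?thesis .
  qed
  moreover have "semigroup_op Q t f \<in> borel_measurable borel"
    using continuous_semigroup_op[OF t f(1) bound] by (rule borel_measurable_continuous_onI)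
  ultimately show "esssup m (\<lambda>x. ennreal \<bar>semigroup_op Q t f x\<bar>) \<le> ennreal C"
    by (intro esssup_I AE_I2 ennreal_leI) measurable
qed

text \<open>Split the time integral at \<open>\<delta> = \<epsilon> / 2\<close>. Earlier times
  contribute at most \<open>\<delta>\<close> because each \<open>Q t x\<close> has mass at most 1;
  for later times the uniform bound \<open>C\<close> on the density leaves at most
  \<open>\<delta>\<close> when \<open>m (- K) < \<delta> / C\<close>.\<close>

lemma assumption_A1_if:
  assumes "locally_compact_space (euclidean :: 'a topology)"
    and bound: "\<And>\<delta>. 0 < \<delta> \<Longrightarrow> \<exists>C. \<forall>t\<ge>\<delta>. \<forall>x y. q t x y \<le> C"
  shows "assumption_A1 Q"
  unfolding assumption_A1_def
proof (intro allI impI)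
  fix \<epsilon> :: real assume "0 < \<epsilon>"
  define \<delta> where "\<delta> = \<epsilon> / 2"
  have "0 < \<delta>" using \<open>0 < \<epsilon>\<close> by (simp add: \<delta>_def)
  then obtain C0 where C0: "\<And>t x y. \<delta> \<le> t \<Longrightarrow> q t x y \<le> C0" using bound[of \<delta>] by blast
  \<comment> \<open>The maximum with 1 makes the bound positive, so that \<open>\<delta> / C\<close>
    is a legitimate target for the measure of \<open>- K\<close>.\<close>
  define C where "C = max C0 1"
  have C: "0 < C" "\<And>t x y. \<delta> \<le> t \<Longrightarrow> q t x y \<le> C"
    using C0 by (auto simp: C_def le_max_iff_disj)
  obtain K where K: "compact K" "measure m (- K) < \<delta> / C"
    using compact_inner_approximation[OF assms(1) finite_measure_axioms sets_m] \<open>0 < \<delta>\<close> C(1)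
    by (metis divide_pos_pos)
  have sets_K: "- K \<in> sets borel"
    using K(1) by (intro borel_open open_Compl compact_imp_closed)
  have small_time: "emeasure (Q t x) (- K) \<le> 1" if "0 < t" for t x
    using emeasure_mono[of "- K" UNIV "Q t x"] subprob[OF that, of x] that
    by (auto simp: Q_eq_density intro: order_trans)
  have large_time: "emeasure (Q t x) (- K) \<le> ennreal \<delta>" if "\<delta> \<le> t" for t x
  proof -
    have "0 < t" using that \<open>0 < \<delta>\<close> by simp
    then have "emeasure (Q t x) (- K) = (\<integral>\<^sup>+y. ennreal (q t x y) * indicator (- K) y \<partial>m)"
      using sets_K by (simp add: Q_eq_density emeasure_density)
    also have "\<dots> \<le> (\<integral>\<^sup>+y. ennreal C * indicator (- K) y \<partial>m)"
      using C(2)[OF that] by (intro nn_integral_mono mult_right_mono) (auto intro: ennreal_leI)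
    also have "\<dots> = ennreal (C * measure m (- K))"
      using sets_K C(1) by (simp add: nn_integral_cmult emeasure_eq_measure ennreal_mult)
    also have "\<dots> \<le> ennreal \<delta>"
      using K(2) C(1) by (intro ennreal_leI) (simp add: field_simps)
    finally show ?thesis .
  qed
  have "resolvent1 Q (indicator (- K)) x \<le> ennreal \<epsilon>" for x
  proof -
    have "resolvent1 Q (indicator (- K)) x = (\<integral>\<^sup>+t\<in>{0<..}. ennreal (exp (- t)) * emeasure (Q t x) (- K) \<partial>lborel)"
      unfolding resolvent1_def using sets_K
      by (intro nn_integral_cong) (auto simp: indicator_def Q_eq_density nn_integral_density emeasure_density)
    also have "\<dots> \<le> (\<integral>\<^sup>+t. indicator {0<..\<delta>} t + ennreal \<delta> * (ennreal (exp (- t)) * indicator {0<..} t) \<partial>lborel)"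
    proof (rule nn_integral_mono)
      fix t :: real
      consider "t \<le> 0" | "0 < t" "t \<le> \<delta>" | "\<delta> < t" by linarith
      then show "ennreal (exp (- t)) * emeasure (Q t x) (- K) * indicator {0<..} t
          \<le> indicator {0<..\<delta>} t + ennreal \<delta> * (ennreal (exp (- t)) * indicator {0<..} t)"
      proof cases
        case 2
        then have "ennreal (exp (- t)) * emeasure (Q t x) (- K) \<le> 1 * 1"
          by (intro mult_mono small_time) auto
        then show ?thesis using 2 by (auto intro: add_increasing2)
      next
        case 3
        then have "emeasure (Q t x) (- K) * ennreal (exp (- t)) \<le> ennreal \<delta> * ennreal (exp (- t))"
          by (intro mult_right_mono large_time) auto
        then show ?thesis using 3 \<open>0 < \<delta>\<close> by (simp add: mult.commute)
      qed simp
    qed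
    also have "\<dots> = ennreal \<delta> + ennreal \<delta> * (\<integral>\<^sup>+t\<in>{0<..}. ennreal (exp (- t)) \<partial>lborel)"
      using \<open>0 < \<delta>\<close> by (simp add: nn_integral_add nn_integral_cmult)
    also have "\<dots> \<le> ennreal \<delta> + ennreal \<delta> * 1"
      by (intro add_left_mono mult_left_mono nn_integral_exp_minus) simp
    also have "\<dots> = ennreal \<epsilon>"
      using \<open>0 < \<delta>\<close> by (simp add: \<delta>_def ennreal_plus[symmetric] del: ennreal_plus)
    finally show ?thesis .
  qed
  with K(1) show "\<exists>K. compact K \<and> (SUP x. resolvent1 Q (indicator (- K)) x) \<le> ennreal \<epsilon>"
    by (intro exI[of _ K]) (auto intro: SUP_least)
qed

lemma assumption_A3_if:
  assumes "0 < a" "0 < c" "0 < c'"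
    and lower: "\<And>t x. 0 < t \<Longrightarrow> t \<le> 1 \<Longrightarrow> c * t powr (- a) \<le> q t x x"
    and upper: "\<And>t x. 0 < t \<Longrightarrow> t \<le> 1 \<Longrightarrow> q t x x \<le> c' * t powr (- a)"
  shows "assumption_A3 m q"
proof -
  define V where "V = measure m UNIV"
  \<comment> \<open>\<open>undefined\<close> serves as an arbitrary point of the nonempty
    space.\<close>
  have "0 < V"
    using ball_pos[of 1 undefined] finite_measure_mono[of "ball undefined 1" UNIV] by (auto simp: V_def)
  \<comment> \<open>One constant for both sides: the first entry serves the upper bound, the second
    gives \<open>inverse C \<le> c * V\<close>.\<close>
  define C where "C = max (c' * V) (1 / (c * V))"
  have "0 < C" using \<open>0 < V\<close> assms by (simp add: C_def less_max_iff_disj)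
  have "c' * V \<le> C" "1 / (c * V) \<le> C" by (auto simp: C_def)
  then have "inverse C \<le> c * V" using \<open>0 < V\<close> \<open>0 < C\<close> assms by (simp add: field_simps)
  have "ennreal (inverse C * t powr (- a)) \<le> (\<integral>\<^sup>+x. ennreal (q t x x) \<partial>m) \<and>
    (\<integral>\<^sup>+x. ennreal (q t x x) \<partial>m) \<le> ennreal (C * t powr (- a))" if t: "0 < t" "t \<le> 1" for t
  proof
    have const: "(\<integral>\<^sup>+x. ennreal (b * t powr (- a)) \<partial>m) = ennreal (b * V * t powr (- a))" if "0 < b" for b
      using that by (simp add: V_def emeasure_eq_measure ennreal_mult[symmetric] mult_ac)
    have "ennreal (inverse C * t powr (- a)) \<le> ennreal (c * V * t powr (- a))"
      using \<open>inverse C \<le> c * V\<close> by (intro ennreal_leI mult_right_mono) auto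
    also have "\<dots> \<le> (\<integral>\<^sup>+x. ennreal (q t x x) \<partial>m)"
      unfolding const[OF \<open>0 < c\<close>, symmetric] using lower t by (intro nn_integral_mono ennreal_leI)
    finally show "ennreal (inverse C * t powr (- a)) \<le> (\<integral>\<^sup>+x. ennreal (q t x x) \<partial>m)" .
    have "(\<integral>\<^sup>+x. ennreal (q t x x) \<partial>m) \<le> ennreal (c' * V * t powr (- a))"
      unfolding const[OF \<open>0 < c'\<close>, symmetric] using upper t by (intro nn_integral_mono ennreal_leI)
    also have "\<dots> \<le> ennreal (C * t powr (- a))"
      using \<open>c' * V \<le> C\<close> by (intro ennreal_leI mult_right_mono) auto
    finally show "(\<integral>\<^sup>+x. ennreal (q t x x) \<partial>m) \<le> ennreal (C * t powr (- a))" .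
  qed
  then show ?thesis
    unfolding assumption_A3_def using \<open>0 < a\<close> \<open>0 < C\<close>
    by (intro exI[of _ "2 * a"] exI[of _ 1] exI[of _ C] conjI) auto
qed

text \<open>The exponent \<open>\<mu> = 2 * b\<close> has to exceed 2 even if
  \<open>a \<le> 1\<close>. Since \<open>t \<le> 1\<close>, replacing \<open>a\<close> by any larger
  \<open>b\<close> only weakens the bound, and the interval between \<open>max 1 a\<close> and p /
  (p - 1) is nonempty.\<close>

lemma assumption_A4_if:
  assumes "0 < c" "2 \<le> p" and a: "a < real p / (real p - 1)"
    and bound: "\<And>t x y. 0 < t \<Longrightarrow> t \<le> 1 \<Longrightarrow> q t x y \<le> c * t powr (- a)"
  shows "assumption_A4 m Q p"
proof -
  have "1 < real p / (real p - 1)" using \<open>2 \<le> p\<close> by (simp add: field_simps)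
  with a have "max 1 a < real p / (real p - 1)" by simp
  then obtain b where b: "max 1 a < b" "b < real p / (real p - 1)" by (rule dense[THEN exE]) blast
  have "norm_L1_Linf m (semigroup_op Q t) \<le> ennreal (c * t powr (- b))" if "0 < t" "t \<le> 1" for t
  proof -
    have "norm_L1_Linf m (semigroup_op Q t) \<le> ennreal (c * t powr (- a))"
      using that by (intro norm_L1_Linf_le bound)
    also have "\<dots> \<le> ennreal (c * t powr (- b))"
      using that b \<open>0 < c\<close> by (intro ennreal_leI mult_left_mono powr_mono') auto
    finally show ?thesis .
  qed
  with b \<open>0 < c\<close> show ?thesis
    unfolding assumption_A4_def by (intro exI[of _ "2 * b"] conjI exI[of _ c] exI[of _ 1]) auto
qed

text \<open>Integrating the bound \<open>near\<close> in time gives a multiple of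
  \<open>dist x y powr (- s)\<close>, with a factor \<open>\<delta> powr (e + 1)\<close> for the
  truncated resolvent. Its p-th power integrates in \<open>y\<close> to at most a multiple of
  \<open>I\<close>, uniformly in \<open>x\<close>.\<close>

lemma assumption_A5_if:
  assumes "0 < B" "0 < c" "- 1 < e" "0 \<le> s" "0 < p"
    and near: "\<And>t x y. 0 < t \<Longrightarrow> t \<le> 1 \<Longrightarrow> x \<noteq> y \<Longrightarrow> q t x y \<le> B * t powr e * dist x y powr (- s)"
    and late: "\<And>t x y. 1 \<le> t \<Longrightarrow> q t x y \<le> c"
    and diam: "\<And>x y :: 'a. dist x y \<le> 1"
    and I: "0 \<le> I" "\<And>x. (\<integral>\<^sup>+y. ennreal (dist x y powr (- (s * real p))) \<partial>m) \<le> ennreal I"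
    and null: "\<And>x. emeasure m {x} = 0"
  shows "assumption_A5 m q p"
proof -
  define A where "A = B / (e + 1)"
  have "0 < A" using assms by (simp add: A_def)
  have upto: "resolvent1_density_upto \<delta> q x y \<le> ennreal (A * \<delta> powr (e + 1) * dist x y powr (- s))"
    if "0 < \<delta>" "\<delta> \<le> 1" "x \<noteq> y" for \<delta> x y
  proof -
    have "resolvent1_density_upto \<delta> q x y
      \<le> (\<integral>\<^sup>+t. ennreal (B * dist x y powr (- s)) * (ennreal (t powr e) * indicator {0<..\<delta>} t) \<partial>lborel)"
      unfolding resolvent1_density_upto_def
    \<comment> \<open>Monotonicity is applied to \<open>q\<close> as it stands; measurability in
      \<open>t\<close> is used only for the explicit majorant.\<close>
    proof (rule nn_integral_mono)
      fix t :: real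
      show "ennreal (exp (- t) * q t x y) * indicator {0<..\<delta>} t
        \<le> ennreal (B * dist x y powr (- s)) * (ennreal (t powr e) * indicator {0<..\<delta>} t)"
      proof (cases "t \<in> {0<..\<delta>}")
        case True
        then have "exp (- t) * q t x y \<le> 1 * (B * t powr e * dist x y powr (- s))"
          using that by (intro mult_mono near q_nonneg) auto
        then show ?thesis
          using True \<open>0 < B\<close> by (simp add: ennreal_mult[symmetric] ennreal_leI mult_ac)
      qed simp
    qed
    also have "\<dots> = ennreal (B * dist x y powr (- s)) * (\<integral>\<^sup>+t\<in>{0<..\<delta>}. ennreal (t powr e) \<partial>lborel)"
      by (rule nn_integral_cmult) measurable
    also have "\<dots> \<le> ennreal (B * dist x y powr (- s)) * ennreal (\<delta> powr (e + 1) / (e + 1))"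
      using that assms by (intro mult_left_mono nn_integral_powr_le) auto
    also have "\<dots> = ennreal (A * \<delta> powr (e + 1) * dist x y powr (- s))"
      using assms by (simp add: A_def ennreal_mult[symmetric] mult_ac)
    finally show ?thesis .
  qed
  have full: "resolvent1_density q x y \<le> ennreal ((A + c) * dist x y powr (- s))" if "x \<noteq> y" for x y
  proof -
    have "resolvent1_density q x y \<le> (\<integral>\<^sup>+t. (ennreal (B * dist x y powr (- s)) * (ennreal (t powr e) * indicator {0<..1} t)
        + ennreal c * (ennreal (exp (- t)) * indicator {0<..} t)) \<partial>lborel)"
      unfolding resolvent1_density_def
    proof (rule nn_integral_mono)
      fix t :: real
      consider "t \<le> 0" | "0 < t" "t \<le> 1" | "1 < t" by linarith
      then show "ennreal (exp (- t) * q t x y) * indicator {0<..} t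
        \<le> ennreal (B * dist x y powr (- s)) * (ennreal (t powr e) * indicator {0<..1} t)
          + ennreal c * (ennreal (exp (- t)) * indicator {0<..} t)"
      proof cases
        case 2
        then have "exp (- t) * q t x y \<le> 1 * (B * t powr e * dist x y powr (- s))"
          using that by (intro mult_mono near q_nonneg) auto
        then have "ennreal (exp (- t) * q t x y) \<le> ennreal (B * dist x y powr (- s)) * ennreal (t powr e)"
          using \<open>0 < B\<close> by (simp add: ennreal_mult[symmetric] ennreal_leI mult_ac)
        then show ?thesis using 2 by (auto intro: add_increasing2)
      next
        case 3
        then have "ennreal (exp (- t) * q t x y) \<le> ennreal (c * exp (- t))"
          using late[of t x y] by (intro ennreal_leI) (simp add: mult.commute)
        then show ?thesis using 3 \<open>0 < c\<close> by (simp add: ennreal_mult)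
      qed simp
    qed
    also have "\<dots> = ennreal (B * dist x y powr (- s)) * (\<integral>\<^sup>+t\<in>{0<..1}. ennreal (t powr e) \<partial>lborel)
        + ennreal c * (\<integral>\<^sup>+t\<in>{0<..}. ennreal (exp (- t)) \<partial>lborel)"
      by (simp add: nn_integral_add nn_integral_cmult)
    also have "\<dots> \<le> ennreal (B * dist x y powr (- s)) * ennreal (1 powr (e + 1) / (e + 1)) + ennreal c * 1"
      using assms by (intro add_mono mult_left_mono nn_integral_powr_le nn_integral_exp_minus) auto
    also have "\<dots> = ennreal (A * dist x y powr (- s) + c)"
      using assms \<open>0 < A\<close> by (simp add: A_def ennreal_mult[symmetric] ennreal_plus[symmetric] mult_ac del: ennreal_plus)
    also have "\<dots> \<le> ennreal ((A + c) * dist x y powr (- s))"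
    proof (rule ennreal_leI)
      \<comment> \<open>As the diameter is at most 1, the negative power of the distance is at least
        1 and absorbs the constant \<open>c\<close> from times after 1.\<close>
      have "1 \<le> dist x y powr (- s)"
        using powr_mono2'[of "- s" "dist x y" 1] diam[of x y] that \<open>0 \<le> s\<close> by simp
      then show "A * dist x y powr (- s) + c \<le> (A + c) * dist x y powr (- s)"
        using \<open>0 < c\<close> by (simp add: algebra_simps)
    qed
    finally show ?thesis .
  qed
  have int_le: "(\<integral>\<^sup>+y. F y ^ p \<partial>m) \<le> ennreal (D ^ p * I)"
    if "0 \<le> D" "\<And>y. x \<noteq> y \<Longrightarrow> F y \<le> ennreal (D * dist x y powr (- s))" for F :: "'a \<Rightarrow> ennreal" and D x
  proof -
    \<comment> \<open>The estimates hold only off the diagonal, so the null point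
      \<open>y = x\<close> is discarded.\<close>
    have "AE y in m. y \<notin> {x}" using null[of x] by (intro AE_not_in) (auto simp: null_sets_def)
    then have "(\<integral>\<^sup>+y. F y ^ p \<partial>m) \<le> (\<integral>\<^sup>+y. ennreal (D ^ p) * ennreal (dist x y powr (- (s * real p))) \<partial>m)"
    proof (intro nn_integral_mono_AE, eventually_elim)
      case (elim y)
      then have "F y ^ p \<le> ennreal (D * dist x y powr (- s)) ^ p"
        using that(2)[of y] by (intro power_mono) auto
      also have "\<dots> = ennreal (D ^ p) * ennreal (dist x y powr (- (s * real p)))"
        using that(1) elim powr_power[of "dist x y" "- s" p]
        by (simp add: ennreal_power power_mult_distrib ennreal_mult mult.commute)
      finally show ?case .
    qed
    also have "\<dots> = ennreal (D ^ p) * (\<integral>\<^sup>+y. ennreal (dist x y powr (- (s * real p))) \<partial>m)"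
      by (rule nn_integral_cmult) measurable
    also have "\<dots> \<le> ennreal (D ^ p) * ennreal I"
      by (intro mult_left_mono I) auto
    finally show ?thesis using that(1) I(1) by (simp add: ennreal_mult)
  qed
  have "(SUP x. \<integral>\<^sup>+y. resolvent1_density q x y ^ p \<partial>m) \<le> ennreal ((A + c) ^ p * I)"
  proof (rule SUP_least)
    show "(\<integral>\<^sup>+y. resolvent1_density q x y ^ p \<partial>m) \<le> ennreal ((A + c) ^ p * I)" for x
      by (rule int_le[where D = "A + c" and x = x and F = "resolvent1_density q x"])
        (use \<open>0 < A\<close> \<open>0 < c\<close> full in simp_all)
  qed
  then have "(SUP x. \<integral>\<^sup>+y. resolvent1_density q x y ^ p \<partial>m) < \<infinity>"
    by (rule order_le_less_trans) simp
  moreover have "((\<lambda>\<delta>. SUP x. \<integral>\<^sup>+y. resolvent1_density_upto \<delta> q x y ^ p \<partial>m) \<longlongrightarrow> 0) (at_right 0)"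
  proof (rule tendsto_sandwich[where f = "\<lambda>_. 0" and h = "\<lambda>\<delta>. ennreal ((A * \<delta> powr (e + 1)) ^ p * I)"])
    \<comment> \<open>The uniform majorant vanishes with \<open>\<delta>\<close> because
      \<open>e + 1\<close> and \<open>p\<close> are positive.\<close>
    have "((\<lambda>\<delta>. \<delta> powr (e + 1)) \<longlongrightarrow> 0) (at_right 0)"
      using \<open>- 1 < e\<close> by real_asymp
    then have "((\<lambda>\<delta>. (A * \<delta> powr (e + 1)) ^ p * I) \<longlongrightarrow> (A * 0) ^ p * I) (at_right 0)"
      by (intro tendsto_intros)
    then have "((\<lambda>\<delta>. (A * \<delta> powr (e + 1)) ^ p * I) \<longlongrightarrow> 0) (at_right 0)"
      using \<open>0 < p\<close> by (simp add: zero_power)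
    from tendsto_ennrealI[OF this]
    show "((\<lambda>\<delta>. ennreal ((A * \<delta> powr (e + 1)) ^ p * I)) \<longlongrightarrow> 0) (at_right 0)" by simp
    have "\<forall>\<^sub>F \<delta> in at_right 0. (0::real) < \<delta> \<and> \<delta> \<le> 1"
      by (auto simp: eventually_at_right_field intro!: exI[of _ 1])
    then show "\<forall>\<^sub>F \<delta> in at_right 0. (SUP x. \<integral>\<^sup>+y. resolvent1_density_upto \<delta> q x y ^ p \<partial>m)
        \<le> ennreal ((A * \<delta> powr (e + 1)) ^ p * I)"
    proof eventually_elim
      case (elim \<delta>)
      show ?case
      proof (rule SUP_least)
        show "(\<integral>\<^sup>+y. resolvent1_density_upto \<delta> q x y ^ p \<partial>m) \<le> ennreal ((A * \<delta> powr (e + 1)) ^ p * I)" for x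
          by (rule int_le[where D = "A * \<delta> powr (e + 1)" and x = x and F = "resolvent1_density_upto \<delta> q x"])
            (use \<open>0 < A\<close> elim upto in simp_all)
      qed
    qed
  qed simp_all
  ultimately show ?thesis by (simp add: assumption_A5_def)
qed

end


section \<open>Assumption (A) from the sub-Gaussian heat kernel and volume bounds\<close>

theorem proposition7p1:
  fixes m :: "'a::{metric_space, second_countable_topology} measure"
    and M :: "'w measure"
    and X :: "ennreal \<Rightarrow> 'w \<Rightarrow> 'a option"
    and P :: "'a option \<Rightarrow> 'w measure"
    and q :: "real \<Rightarrow> 'a \<Rightarrow> 'a \<Rightarrow> real"
    and c1 c2 c3 c4 c5 df dw :: real
    and p :: nat
  assumes "locally_compact_space (euclidean :: 'a topology)"
    and "connected (UNIV :: 'a set)"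
    and "bounded (UNIV :: 'a set)" and "diameter (UNIV :: 'a set) = 1"
    and "sets m = sets borel" and "emeasure m UNIV < \<infinity>" and "measure_support m = UNIV"
    and "hunt_process M X P"
    and "symmetric_wrt m (transition_prob X P)"
    and "transition_density m (transition_prob X P) q"
    and "\<And>t x. t > 0 \<Longrightarrow> continuous_on UNIV (\<lambda>y. q t x y)"
    and "\<And>t y. t > 0 \<Longrightarrow> continuous_on UNIV (\<lambda>x. q t x y)"
    and "c1 > 0" "c2 > 0" "c3 > 0" "c4 > 0" "c5 > 0" "df \<ge> 1" "dw \<ge> 2"
    and "\<And>x t. 0 < t \<Longrightarrow> t \<le> 1 \<Longrightarrow> c1 * t powr (- (df / dw)) \<le> q t x x"
    and "\<And>x y t. 0 < t \<Longrightarrow> t \<le> 1 \<Longrightarrow>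
           q t x y \<le> c2 * t powr (- (df / dw)) *
             exp (- (c3 * (dist x y powr dw / t) powr (1 / (dw - 1))))"
    and "\<And>x r. 0 < r \<Longrightarrow> r \<le> 1 \<Longrightarrow> c4 * r powr df \<le> measure m (ball x r)"
    and "\<And>x r. 0 < r \<Longrightarrow> r \<le> 1 \<Longrightarrow> measure m (ball x r) \<le> c5 * r powr df"
    and "p \<ge> 2"
    and "df - real p * (df - dw) > 0"
  shows "assumption_A m (transition_prob X P) q p"
proof -
  have space_m: "space m = UNIV"
    using sets_eq_imp_space_eq[OF assms(5)] by simp
  then interpret finite_measure m
    using assms(6) by (intro finite_measureI) auto
  have ball_pos: "0 < measure m (ball x r)" if "0 < r" for x r
  proof -
    \<comment> \<open>The volume bound is available for radii up to 1, hence the truncated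
      radius.\<close>
    have "0 < c4 * (min r 1) powr df" using that \<open>c4 > 0\<close> by simp
    also have "\<dots> \<le> measure m (ball x (min r 1))" using that by (intro assms(22)) auto
    also have "\<dots> \<le> measure m (ball x r)"
      by (intro finite_measure_mono) (auto simp: assms(5))
    finally show ?thesis .
  qed
  interpret heat_kernel m "transition_prob X P" q
    using assms(5,10-12) ball_pos
      hunt.emeasure_transition_prob_le_1[OF hunt.intro[OF assms(8)]]
      hunt.measurable_emeasure_transition_prob[OF hunt.intro[OF assms(8)]]
      hunt.Chapman_Kolmogorov_measure[OF hunt.intro[OF assms(8)]]
    by unfold_locales auto
  define a where "a = df / dw"
  have "0 < dw" "0 < a" using assms(18,19) by (auto simp: a_def)
  \<comment> \<open>The dimension hypothesis divided by \<open>dw\<close>. Both the strict bound on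
    \<open>a\<close> for (A4) and the room for \<open>k\<close> in (A5) come from it.\<close>
  have a_less: "a * real p < a + real p"
  proof -
    have "df * real p < df + real p * dw"
      using assms(25) by (simp add: algebra_simps)
    then show ?thesis using \<open>0 < dw\<close> by (simp add: a_def field_simps)
  qed
  have upper: "q t x y \<le> c2 * t powr (- a)" if "0 < t" "t \<le> 1" for t x y
  proof -
    have "q t x y \<le> c2 * t powr (- (df / dw)) * exp (- (c3 * (dist x y powr dw / t) powr (1 / (dw - 1))))"
      using that by (rule assms(21))
    also have "\<dots> \<le> c2 * t powr (- (df / dw)) * 1"
      using \<open>c2 > 0\<close> \<open>c3 > 0\<close> by (intro mult_left_mono) auto
    finally show ?thesis by (simp add: a_def)
  qed
  have away: "q t x y \<le> c2 * \<delta> powr (- a)" if "0 < \<delta>" "\<delta> \<le> 1" "\<delta> \<le> t" for \<delta> t x y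
    by (rule bounded_away_from_0) (use that upper \<open>c2 > 0\<close> \<open>0 < a\<close> in auto)
  have bounded: "\<exists>C. \<forall>t\<ge>\<delta>. \<forall>x y. q t x y \<le> C" if "0 < \<delta>" for \<delta>
    using away[of "min \<delta> 1"] that by (intro exI[of _ "c2 * min \<delta> 1 powr (- a)"]) auto

  have A1: "assumption_A1 (transition_prob X P)"
    using assms(1) bounded by (rule assumption_A1_if)
  have A2: "assumption_A2 m (transition_prob X P) q"
    using bounded by (intro assumption_A2_if) blast
  have A3: "assumption_A3 m q"
    using \<open>0 < a\<close> \<open>c1 > 0\<close> \<open>c2 > 0\<close> assms(20) upper
    by (intro assumption_A3_if[of a c1 c2]) (auto simp: a_def)
  have A4: "assumption_A4 m (transition_prob X P) p"
  proof (rule assumption_A4_if[OF \<open>c2 > 0\<close> \<open>p \<ge> 2\<close> _ upper])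
    show "a < real p / (real p - 1)"
      using a_less \<open>p \<ge> 2\<close> by (simp add: field_simps)
  qed
  have A5: "assumption_A5 m q p"
  proof -
    have "0 < real p" using \<open>p \<ge> 2\<close> by simp
    then have "max 0 (a - 1) < a / real p"
      using a_less \<open>0 < a\<close> by (simp add: field_simps)
    then obtain k where k: "max 0 (a - 1) < k" "k < a / real p" by (rule dense[THEN exE]) blast
    \<comment> \<open>Exactly what (A5) asks of \<open>k\<close>: time integrability at 0, and a
      distance exponent below the volume exponent after taking p-th powers.\<close>
    then have k': "0 < k" "- 1 < k - a" "k * dw * real p < df"
      using \<open>0 < dw\<close> \<open>0 < real p\<close> by (auto simp: a_def field_simps)
    obtain I where I: "0 \<le> I" "\<And>x. (\<integral>\<^sup>+y. ennreal (dist x y powr (- (k * dw * real p))) \<partial>m) \<le> ennreal I"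
      using nn_integral_dist_powr_le[OF finite_measure_axioms assms(5) _ k'(3) _ assms(23)]
        k'(1) \<open>0 < dw\<close> \<open>0 < real p\<close> \<open>c5 > 0\<close>
      by (metis less_imp_le mult_pos_pos)
    \<comment> \<open>The constant produced by \<open>sub_gaussian_le_powr\<close> with
      \<open>\<beta> = dw\<close>.\<close>
    define B where "B = c2 * (k * (dw - 1) / c3) powr (k * (dw - 1))"
    show ?thesis
    proof (rule assumption_A5_if[of B c2 "k - a" "k * dw" p I])
      show "0 < B" using \<open>c2 > 0\<close> \<open>c3 > 0\<close> \<open>0 < k\<close> \<open>dw \<ge> 2\<close> by (simp add: B_def)
      show "q t x y \<le> B * t powr (k - a) * dist x y powr (- (k * dw))" if "0 < t" "t \<le> 1" "x \<noteq> y" for t x y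
      proof -
        note assms(21)[OF that(1,2), of x y]
        also have "c2 * t powr (- (df / dw)) * exp (- (c3 * (dist x y powr dw / t) powr (1 / (dw - 1))))
            \<le> B * t powr (k - a) * dist x y powr (- (k * dw))"
          unfolding B_def a_def
          by (rule sub_gaussian_le_powr) (use that \<open>c2 > 0\<close> \<open>c3 > 0\<close> \<open>0 < k\<close> \<open>dw \<ge> 2\<close> in auto)
        finally show ?thesis .
      qed
      show "q t x y \<le> c2" if "1 \<le> t" for t x y
        using away[of 1 t] that by simp
      show "dist x y \<le> 1" for x y :: 'a
        using diameter_bounded_bound[OF assms(3), of x y] assms(4) by simp
      show "emeasure m {x} = 0" for x
        using assms(18,23) by (intro emeasure_singleton_eq_0[OF finite_measure_axioms assms(5)]) auto
    qed (use I k' \<open>c2 > 0\<close> \<open>0 < dw\<close> \<open>p \<ge> 2\<close> in auto)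
  qed
  show ?thesis
    using A1 A2 A3 A4 A5 by (simp add: assumption_A_def)
qed

end
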